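(* Let $0\le k\le\mu$ be integers. For every $f\in C(\mathbb{CP}^1)$ and every positive integer $n$, $$\lim_{\nu\to\infty}\frac1\nu\,\mathrm{Tr}\Big(\mathcal{T}^\nu_{\mu,k}\big(R_\mu^*(f)\big)^n\Big)=\int_{\mathbb{C}}E_{\mu,k}(f)^n\,d\iota(z).$$
   Context: For an integer $\tau\ge0$, $\mathcal{H}_\tau$ is the space of polynomials in one complex variable of degree $\le\tau$, with inner product $\langle f,g\rangle=\int_{\mathbb{C}}f\overline g\,d\iota_\tau$, $d\iota_\tau(z)=\frac{\tau+1}{(1+|z|^2)^\tau}\frac{dA(z)}{\pi(1+|z|^2)^2}$ ($dA$ Lebesgue measure); $d\iota:=d\iota_0$. $C(\mathbb{CP}^1)$: continuous functions on $\mathbb{C}$ extending continuously to $\infty$. $R_\mu^*(f)$ is the operator on $\mathcal{H}_\mu$ with $(R_\mu^*(f)h)(x)=\frac1{\mu+1}\int_{\mathbb{C}}f(z)h(z)(1+x\overline z)^\mu d\iota_\mu(z)$. $B_\tau(f)(z)=\int_{\mathbb{C}}\frac{|1+z\overline s|^{2\tau}}{(1+|z|^2)^\tau(1+|s|^2)^\tau}f(s)\,d\iota(s)$ is the Berezin transform and $E_{\mu,k}(f):=\binom{\mu}{k}\sum_{l=0}^k(-1)^{k-l}\binom kl B_{\mu-l}(f)$. For $\nu>\mu$: $\mathcal{H}_\mu\otimes\mathcal{H}_\nu$ is realized as polynomials $F(z,w)$ of degree $\le\mu$ in $z$, $\le\nu$ in $w$, with inner product of $L^2(d\iota_\mu(z)d\iota_\nu(w))$;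 $J_k(F)(\xi)=\int_{\mathbb{C}^2}F(z,w)(\overline z-\overline w)^k(1+\xi\overline z)^{\mu-k}(1+\xi\overline w)^{\nu-k}d\iota_\mu(z)d\iota_\nu(w)\in\mathcal{H}_{\mu+\nu-2k}$; $C_{\mu,\nu,k}>0$ with $C_{\mu,\nu,k}^2=\frac{(-\nu)_k(-\mu)_k}{k!(\mu+\nu-2k+2)_k}$ (rising Pochhammer $(a)_n=a(a+1)\cdots(a+n-1)$); $P_k=C_{\mu,\nu,k}J_k$; and $\mathcal{T}^\nu_{\mu,k}(A)=P_k(A\otimes I)P_k^*\in B(\mathcal{H}_{\mu+\nu-2k})$ for $A\in B(\mathcal{H}_\mu)$, $I$ the identity of $\mathcal{H}_\nu$. *)

theory Defs
  imports "HOL-Analysis.Analysis"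
begin

definition iota_dens :: "nat \<Rightarrow> complex \<Rightarrow> real" where
  "iota_dens \<tau> z = (real \<tau> + 1) / (1 + (cmod z)^2) ^ \<tau> / (pi * (1 + (cmod z)^2)^2)"

definition iota :: "nat \<Rightarrow> complex measure" where
  "iota \<tau> = density lborel (\<lambda>z. ennreal (iota_dens \<tau> z))"

definition H :: "nat \<Rightarrow> (complex \<Rightarrow> complex) set" where
  "H \<tau> = {g. \<exists>p::complex poly. degree p \<le> \<tau> \<and> g = poly p}"

definition inner_H :: "nat \<Rightarrow> (complex \<Rightarrow> complex) \<Rightarrow> (complex \<Rightarrow> complex) \<Rightarrow> complex" where
  "inner_H \<tau> f g = (LINT z|iota \<tau>. f z * cnj (g z))"

definition onb :: "nat \<Rightarrow> nat \<Rightarrow> complex \<Rightarrow> complex" where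
  "onb \<tau> j = (\<lambda>z. complex_of_real (sqrt (real (\<tau> choose j))) * z ^ j)"

definition trace_H :: "nat \<Rightarrow> ((complex \<Rightarrow> complex) \<Rightarrow> (complex \<Rightarrow> complex)) \<Rightarrow> complex" where
  "trace_H \<tau> A = (\<Sum>j\<le>\<tau>. inner_H \<tau> (A (onb \<tau> j)) (onb \<tau> j))"

definition cont_CP1 :: "(complex \<Rightarrow> complex) \<Rightarrow> bool" where
  "cont_CP1 f \<longleftrightarrow> continuous_on UNIV f \<and> (\<exists>L. (f \<longlongrightarrow> L) at_infinity)"

definition Rstar :: "nat \<Rightarrow> (complex \<Rightarrow> complex) \<Rightarrow> (complex \<Rightarrow> complex) \<Rightarrow> (complex \<Rightarrow> complex)" where
  "Rstar \<mu> f h = (\<lambda>x. (1 / (of_nat \<mu> + 1)) *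
      (LINT z|iota \<mu>. f z * h z * (1 + x * cnj z) ^ \<mu>))"

definition Berezin :: "nat \<Rightarrow> (complex \<Rightarrow> complex) \<Rightarrow> complex \<Rightarrow> complex" where
  "Berezin \<tau> f z = (LINT s|iota 0.
      complex_of_real ((cmod (1 + z * cnj s)) ^ (2 * \<tau>) /
        ((1 + (cmod z)^2) ^ \<tau> * (1 + (cmod s)^2) ^ \<tau>)) * f s)"

definition E :: "nat \<Rightarrow> nat \<Rightarrow> (complex \<Rightarrow> complex) \<Rightarrow> complex \<Rightarrow> complex" where
  "E \<mu> k f z = of_nat (\<mu> choose k) *
      (\<Sum>l\<le>k. (-1) ^ (k - l) * of_nat (k choose l) * Berezin (\<mu> - l) f z)"

text \<open>Elements of H_mu (x) H_nu are realised as functions F z w.\<close>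
definition Jk :: "nat \<Rightarrow> nat \<Rightarrow> nat \<Rightarrow> (complex \<Rightarrow> complex \<Rightarrow> complex) \<Rightarrow> complex \<Rightarrow> complex" where
  "Jk \<mu> \<nu> k F = (\<lambda>\<xi>. LINT p|(iota \<mu> \<Otimes>\<^sub>M iota \<nu>).
      F (fst p) (snd p) * (cnj (fst p) - cnj (snd p)) ^ k *
      (1 + \<xi> * cnj (fst p)) ^ (\<mu> - k) * (1 + \<xi> * cnj (snd p)) ^ (\<nu> - k))"

definition Cmnk :: "nat \<Rightarrow> nat \<Rightarrow> nat \<Rightarrow> real" where
  "Cmnk \<mu> \<nu> k = sqrt (pochhammer (- real \<nu>) k * pochhammer (- real \<mu>) k /
      (fact k * pochhammer (real \<mu> + real \<nu> - 2 * real k + 2) k))"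

definition Pk :: "nat \<Rightarrow> nat \<Rightarrow> nat \<Rightarrow> (complex \<Rightarrow> complex \<Rightarrow> complex) \<Rightarrow> complex \<Rightarrow> complex" where
  "Pk \<mu> \<nu> k F = (\<lambda>\<xi>. complex_of_real (Cmnk \<mu> \<nu> k) * Jk \<mu> \<nu> k F \<xi>)"

text \<open>Adjoint of P_k, written in the orthonormal basis e_a (x) e_b of H_mu (x) H_nu.\<close>
definition Pk_adj :: "nat \<Rightarrow> nat \<Rightarrow> nat \<Rightarrow> (complex \<Rightarrow> complex) \<Rightarrow> complex \<Rightarrow> complex \<Rightarrow> complex" where
  "Pk_adj \<mu> \<nu> k g = (\<lambda>z w. \<Sum>a\<le>\<mu>. \<Sum>b\<le>\<nu>.
      inner_H (\<mu> + \<nu> - 2 * k) g (Pk \<mu> \<nu> k (\<lambda>z' w'. onb \<mu> a z' * onb \<nu> b w'))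
        * onb \<mu> a z * onb \<nu> b w)"

text \<open>A (x) I: apply A in the first variable (A linear).\<close>
definition tensor_id :: "((complex \<Rightarrow> complex) \<Rightarrow> (complex \<Rightarrow> complex)) \<Rightarrow>
    (complex \<Rightarrow> complex \<Rightarrow> complex) \<Rightarrow> complex \<Rightarrow> complex \<Rightarrow> complex" where
  "tensor_id A F = (\<lambda>z w. A (\<lambda>z'. F z' w) z)"

definition Tmap :: "nat \<Rightarrow> nat \<Rightarrow> nat \<Rightarrow> ((complex \<Rightarrow> complex) \<Rightarrow> (complex \<Rightarrow> complex)) \<Rightarrow>
    (complex \<Rightarrow> complex) \<Rightarrow> (complex \<Rightarrow> complex)" where
  "Tmap \<mu> \<nu> k A = (\<lambda>g. Pk \<mu> \<nu> k (tensor_id A (Pk_adj \<mu> \<nu> k g)))"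

end

theory Submission
  imports Defs "HOL-Real_Asymp.Real_Asymp"
begin

text \<open>
  In the bases \<open>onb\<close>, the map \<open>Pk\<close> sends \<open>e\<^sub>a \<otimes> e\<^sub>b\<close> to a real multiple (a Clebsch-Gordan coefficient)
  of \<open>e\<^sub>a\<^sub>+\<^sub>b\<^sub>-\<^sub>k\<close>, so the operator \<open>Tmap \<mu> \<nu> k A\<close> is a band matrix of width \<open>\<mu>\<close> built from
  the fixed \<open>(\<mu>+1) \<times> (\<mu>+1)\<close> matrix of \<open>A\<close> and these coefficients. Along indices \<open>b\<close> with
  \<open>b / \<nu> \<longlonglongrightarrow> x\<close> the coefficients converge, since they are finite sums of square roots of quotients
  of binomial coefficients with bounded shifts. Hence the diagonal entries of the \<open>n\<close>-th power at
  \<open>\<lfloor>\<nu> x\<rfloor>\<close> converge boundedly to the zeroth Fourier coefficient of the \<open>n\<close>-th power of a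
  trigonometric polynomial depending on \<open>x\<close>, and dominated convergence turns the normalised trace
  into the integral of this coefficient over \<open>[0,1]\<close>. In the coordinates
  \<open>x = |z|\<^sup>2 / (1 + |z|\<^sup>2)\<close> and \<open>sgn z\<close> on the sphere, where \<open>\<iota>\<close> is the uniform measure, the
  trigonometric polynomial is \<open>E \<mu> k f\<close>: both are the expectation of \<open>A\<close> in the vector
  \<open>(1 + s * cnj z)\<^sup>\<mu>\<^sup>-\<^sup>k (s - z)\<^sup>k\<close>.
\<close>

section \<open>The measure on the sphere\<close>

text \<open>Since \<mu> is fixed, \<open>f\<close> is seen only through finitely many matrix
  entries, and all dependence on \<nu> sits in the coefficients. Away from both ends of the index
  range the band matrix is locally Toeplitz: near index \<open>b\<close> its entries depend, in the
  limit, only on \<open>x\<close> and on the difference of the two indices. Multiplying such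
  matrices convolves their diagonals, which is multiplication of trigonometric polynomials; this is
  how the power gets inside the integral. A fixed \<open>x\<close> strictly between 0 and 1 keeps
  every index reached by \<open>n\<close> steps of length at most \<mu> in the interior, and the
  ends of the range cost nothing in the mean.

  The vector behind \<open>E\<close> comes from its alternating sum. If \<open>q\<close> is the
  squared overlap of the normalised coherent states at \<open>z\<close> and \<open>s\<close>, that
  sum integrates \<open>f\<close> against \<open>q ^ (\<mu> - k) * (1 - q) ^ k\<close>, and
  \<open>1 - q\<close> is the squared chordal distance of the two points in units of the diameter.
  The kernel is thus the squared modulus of a polynomial in \<open>s\<close>. The factor
  \<open>\<mu> choose k\<close> of \<open>E\<close> is the limit of the square of
  \<open>Cmnk\<close>.\<close>

lemma lborel_complex_eq_distr_vec:
  "(lborel :: complex measure) = distr lborel borel (\<lambda>v::real^2. Complex (v$1) (v$2))"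
proof (rule lborel_eqI)
  have cont: "continuous_on UNIV (\<lambda>v::real^2. Complex (v$1) (v$2))"
    unfolding Complex_eq by (intro continuous_intros)
  fix l u :: complex
  assume le: "\<And>b. b \<in> Basis \<Longrightarrow> l \<bullet> b \<le> u \<bullet> b"
  have le': "Re l \<le> Re u" "Im l \<le> Im u"
    using le[of 1] le[of \<i>] by (simp_all add: Basis_complex_def)
  define l' u' :: "real^2" where "l' = vector [Re l, Im l]" and "u' = vector [Re u, Im u]"
  have vim: "(\<lambda>v::real^2. Complex (v$1) (v$2)) -` box l u = box l' u'"
    by (auto simp: mem_box_cart mem_box Basis_complex_def l'_def u'_def vector_2 forall_2)
  have B: "(Basis :: (real^2) set) = {axis 1 1, axis 2 1}"
    by (auto simp: Basis_vec_def UNIV_2)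
  have ne: "(axis 1 1 :: real^2) \<noteq> axis 2 1"
    by (simp add: axis_eq_axis)
  have "emeasure (distr lborel borel (\<lambda>v::real^2. Complex (v$1) (v$2))) (box l u)
      = emeasure lborel (box l' u')"
    using cont by (subst emeasure_distr) (auto simp: vim intro: borel_measurable_continuous_onI)
  also have "\<dots> = (\<Prod>b\<in>Basis. (u' - l') \<bullet> b)"
    by (rule emeasure_lborel_box) (auto simp: B inner_axis l'_def u'_def vector_2 le')
  also have "\<dots> = (\<Prod>b\<in>Basis. (u - l) \<bullet> b)"
    using ne by (simp add: B inner_axis l'_def u'_def vector_2 Basis_complex_def)
  finally show "emeasure (distr lborel borel (\<lambda>v::real^2. Complex (v$1) (v$2))) (box l u)
      = (\<Prod>b\<in>Basis. (u - l) \<bullet> b)" .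
qed simp

text \<open>Read on \<open>real^2\<close>, multiplication by a unit number is an orthogonal map, and
  orthogonal maps preserve Lebesgue measure. Rotations are what separates the angular modes in the
  integrals over the sphere.\<close>

lemma distr_lborel_rotation:
  fixes c :: complex
  assumes c: "cmod c = 1"
  shows "distr lborel borel (\<lambda>z. c * z) = lborel"
proof (rule lborel_eqI[symmetric])
  define h where "h = (\<lambda>v::real^2. Complex (v$1) (v$2))"
  define h' where "h' = (\<lambda>z. vector [Re z, Im z] :: real^2)"
  define g where "g = (\<lambda>v. h' (cnj c * h v))"
  have hm[measurable]: "h \<in> borel_measurable borel"
    unfolding h_def Complex_eq by (intro borel_measurable_continuous_onI continuous_intros)
  have hh': "h (h' z) = z" for z by (simp add: h_def h'_def vector_2)
  have h'h: "h' (h v) = v" for v by (simp add: h_def h'_def vec_eq_iff forall_2 vector_2)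
  have cc: "c * cnj c = 1" using c by (simp add: complex_norm_square[symmetric])
  have norm_h': "norm (h' z) = cmod z" for z
    by (simp add: h'_def norm_vec_def L2_set_def sum_2 vector_2 cmod_def)
  have norm_h: "cmod (h v) = norm v" for v
    using norm_h'[of "h v"] by (simp add: h'h)
  have g: "orthogonal_transformation g"
    unfolding orthogonal_transformation
  proof
    show "linear g"
      by (rule linearI)
         (auto simp: g_def h_def h'_def vec_eq_iff forall_2 vector_2 algebra_simps)
    show "\<forall>v. norm (g v) = norm v"
      using c by (simp add: g_def norm_h' norm_h norm_mult)
  qed
  fix l u :: complex
  assume le: "\<And>b. b \<in> Basis \<Longrightarrow> l \<bullet> b \<le> u \<bullet> b"
  define S where "S = h -` box l u"
  have Sm: "S \<in> sets lborel" unfolding S_def using measurable_sets[OF hm, of "box l u"] by simp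
  have eS: "emeasure lborel S = emeasure lborel (box l u)"
    unfolding S_def lborel_complex_eq_distr_vec h_def[symmetric] by (subst emeasure_distr) auto
  have vim: "h -` ((\<lambda>z. c * z) -` box l u) = g ` S"
  proof (intro set_eqI iffI)
    fix v assume "v \<in> h -` ((\<lambda>z. c * z) -` box l u)"
    then have "h' (c * h v) \<in> S" by (simp add: S_def hh')
    moreover have "g (h' (c * h v)) = v"
    proof -
      have "cnj c * (c * h v) = h v" using cc by (metis mult.assoc mult.commute mult_1)
      then show ?thesis unfolding g_def hh' by (simp only: h'h)
    qed
    ultimately show "v \<in> g ` S" by (metis imageI)
  next
    fix v assume "v \<in> g ` S"
    then show "v \<in> h -` ((\<lambda>z. c * z) -` box l u)"
      using cc by (auto simp: g_def hh' mult.assoc[symmetric] S_def)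
  qed
  have fin: "emeasure lborel S < \<infinity>" using eS emeasure_lborel_box_finite[of l u] by simp
  then have lm: "S \<in> lmeasurable"
    using Sm by (auto simp: fmeasurable_def)
  have vm: "(\<lambda>z. c * z) -` box l u \<in> sets borel"
  proof -
    have "(\<lambda>z. c * z) \<in> borel_measurable borel" by measurable
    from measurable_sets[OF this, of "box l u"] show ?thesis by simp
  qed
  have gm: "g ` S \<in> sets borel"
    unfolding vim[symmetric] using measurable_sets[OF hm vm] by simp
  have "emeasure (distr lborel borel (\<lambda>z. c * z)) (box l u) = emeasure lborel ((\<lambda>z. c * z) -` box l u)"
    by (subst emeasure_distr) auto
  also have "\<dots> = emeasure lborel (g ` S)"
    unfolding lborel_complex_eq_distr_vec h_def[symmetric]
    using vm by (subst emeasure_distr) (auto simp: vim)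
  also have "\<dots> = emeasure lebesgue (g ` S)" using gm by simp
  also have "\<dots> = measure lebesgue (g ` S)"
    using measurable_orthogonal_image[OF g lm] by (simp add: emeasure_eq_measure2)
  also have "\<dots> = measure lebesgue S"
    using measure_orthogonal_image[OF g lm] by simp
  also have "\<dots> = emeasure lebesgue S" using lm by (simp add: emeasure_eq_measure2)
  also have "\<dots> = emeasure lborel (box l u)" using Sm eS by simp
  finally show "emeasure (distr lborel borel (\<lambda>z. c * z)) (box l u) = (\<Prod>b\<in>Basis. (u - l) \<bullet> b)"
    using le by simp
qed simp

text \<open>The disc of radius \<open>sqrt a\<close> has area \<open>pi * a\<close>, which is linear
  in \<open>a\<close>, and half-lines determine the measure.\<close>

lemma distr_lborel_cmod_square:
  "distr lborel borel (\<lambda>z::complex. (cmod z)^2) = density lborel (\<lambda>t. ennreal pi * indicator {0..} t)"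
proof (rule measure_eqI_generator_eq[where E="range (\<lambda>a::real. {..a})" and A="\<lambda>n. {..real n}" and \<Omega>=UNIV])
  have fin: "emeasure (distr lborel borel (\<lambda>z::complex. (cmod z)^2)) {..a} = (if a < 0 then 0 else ennreal (pi * a))" for a
  proof -
    have "(\<lambda>z::complex. (cmod z)^2) -` {..a} = (if a < 0 then {} else cball 0 (sqrt a))"
    proof (cases "a < 0")
      case True
      then have "\<not> (cmod z)^2 \<le> a" for z
        using zero_le_power2[of "cmod z"] by linarith
      then show ?thesis using True by auto
    next
      case False
      then have "(cmod z)^2 \<le> a \<longleftrightarrow> cmod z \<le> sqrt a" for z
        using real_sqrt_le_iff[of "(cmod z)^2" a] by simp
      then show ?thesis using False by (auto simp: dist_norm)
    qed
    then show ?thesis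
      by (subst emeasure_distr) (auto simp: emeasure_cball unit_ball_vol_2)
  qed
  have "emeasure (density lborel (\<lambda>t. ennreal pi * indicator {0..} t)) {..a} = (if a < 0 then 0 else ennreal (pi * a))" for a :: real
  proof -
    have "emeasure (density lborel (\<lambda>t. ennreal pi * indicator {0..} t)) {..a} =
        (\<integral>\<^sup>+t. ennreal pi * indicator {0..a} t \<partial>lborel)"
      by (subst emeasure_density) (auto intro!: nn_integral_cong split: split_indicator)
    also have "\<dots> = ennreal pi * emeasure lborel {0..a}"
      by (subst nn_integral_cmult) auto
    finally show ?thesis by (auto simp: ennreal_mult)
  qed
  then show "emeasure (distr lborel borel (\<lambda>z::complex. (cmod z)^2)) X
    = emeasure (density lborel (\<lambda>t. ennreal pi * indicator {0..} t)) X" if "X \<in> range (\<lambda>a::real. {..a})" for X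
    using that fin by auto
  show "emeasure (distr lborel borel (\<lambda>z::complex. (cmod z)^2)) {..real i} \<noteq> \<infinity>" for i
    unfolding fin by simp
  show "Int_stable (range (\<lambda>a::real. {..a}))"
    by (auto simp: Int_stable_def)
  show "(\<Union>i. {..real i}) = UNIV" using real_arch_simple by auto
  show "sets (distr lborel borel (\<lambda>z::complex. (cmod z)^2)) = sigma_sets UNIV (range (\<lambda>a::real. {..a}))"
    by (simp add: borel_eq_atMost[where 'a=real])
  show "sets (density lborel (\<lambda>t. ennreal pi * indicator {0..} t)) = sigma_sets UNIV (range (\<lambda>a::real. {..a}))"
    by (simp add: borel_eq_atMost[where 'a=real])
qed auto

text \<open>Under stereographic projection this is the height on the sphere, rescaled to run from 0
  at the origin to 1 at infinity.\<close>

definition sphere_coord :: "complex \<Rightarrow> real" where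
  "sphere_coord z = (cmod z)^2 / (1 + (cmod z)^2)"

lemma one_plus_cmod_square_pos [simp]: "0 < 1 + (cmod z)^2"
  by (simp add: add_pos_nonneg)

lemma one_plus_cmod_square_neq_0 [simp]: "1 + (cmod z)^2 \<noteq> 0"
  using one_plus_cmod_square_pos[of z] by linarith

lemma sphere_coord_nonneg [simp]: "0 \<le> sphere_coord z" and sphere_coord_less_1 [simp]: "sphere_coord z < 1"
  by (simp_all add: sphere_coord_def)

lemma sphere_coord_measurable [measurable]: "sphere_coord \<in> borel_measurable borel"
  unfolding sphere_coord_def by measurable

lemma iota_dens_nonneg [simp]: "0 \<le> iota_dens \<tau> z"
  by (simp add: iota_dens_def)

lemma iota_dens_measurable [measurable]: "iota_dens \<tau> \<in> borel_measurable borel"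
  unfolding iota_dens_def by measurable

lemma sets_iota [simp, measurable_cong]: "sets (iota \<tau>) = sets borel"
  by (simp add: iota_def)

lemma space_iota [simp]: "space (iota \<tau>) = UNIV"
  by (simp add: iota_def)

text \<open>Archimedes: the height of a uniform point of the sphere is uniformly distributed. For
  \<open>t = (cmod z)^2\<close> the density is \<open>1 / (1 + t)^2\<close> on the half-line, the
  derivative of \<open>t / (1 + t)\<close>.\<close>

lemma distr_iota_sphere_coord:
  "distr (iota 0) borel sphere_coord = density lborel (indicator {0..1})"
proof (rule measure_eqI_lessThan)
  have eq: "emeasure (distr (iota 0) borel sphere_coord) {c<..} = (if c < 0 then 1 else if c < 1 then ennreal (1 - c) else 0)" for c
  proof -
    have "emeasure (distr (iota 0) borel sphere_coord) {c<..} = emeasure (iota 0) (sphere_coord -` {c<..})"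
      by (subst emeasure_distr) auto
    also have "\<dots> = (\<integral>\<^sup>+z. ennreal (iota_dens 0 z) * indicator {c<..} (sphere_coord z) \<partial>lborel)"
    proof -
      have "sphere_coord -` {c<..} \<in> sets borel"
        using measurable_sets[OF sphere_coord_measurable, of "{c<..}"] by simp
      then show ?thesis
        unfolding iota_def by (subst emeasure_density) (auto intro!: nn_integral_cong split: split_indicator)
    qed
    also have "\<dots> = (\<integral>\<^sup>+z. (\<lambda>t. ennreal (1 / (pi * (1 + t)^2)) * indicator {c<..} (t / (1 + t))) ((cmod z)^2) \<partial>lborel)"
      by (intro nn_integral_cong) (simp add: iota_dens_def sphere_coord_def)
    also have "\<dots> = (\<integral>\<^sup>+t. ennreal (1 / (pi * (1 + t)^2)) * indicator {c<..} (t / (1 + t)) \<partial>distr lborel borel (\<lambda>z::complex. (cmod z)^2))"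
      by (subst nn_integral_distr) auto
    also have "\<dots> = (\<integral>\<^sup>+t. (ennreal pi * indicator {0..} t) * (ennreal (1 / (pi * (1 + t)^2)) * indicator {c<..} (t / (1 + t))) \<partial>lborel)"
      unfolding distr_lborel_cmod_square by (subst nn_integral_density) auto
    also have "\<dots> = (\<integral>\<^sup>+t. ennreal (1 / (1 + t)^2) * (indicator {0..} t * indicator {c<..} (t / (1 + t))) \<partial>lborel)"
    proof (intro nn_integral_cong)
      fix t :: real
      have "ennreal pi * ennreal (1 / (pi * (1 + t)^2)) = ennreal (1 / (1 + t)^2)"
        by (subst ennreal_mult[symmetric]) auto
      then show "(ennreal pi * indicator {0..} t) * (ennreal (1 / (pi * (1 + t)^2)) * indicator {c<..} (t / (1 + t))) =
        ennreal (1 / (1 + t)^2) * (indicator {0..} t * indicator {c<..} (t / (1 + t)))"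
        by (auto simp: mult_ac split: split_indicator)
    qed
    also have "\<dots> = (if c < 0 then 1 else if c < 1 then ennreal (1 - c) else 0)"
    proof -
      have lim: "((\<lambda>t::real. - 1 / (1 + t)) \<longlongrightarrow> 0) at_top"
        by (intro tendsto_divide_0[OF tendsto_const] filterlim_at_top_imp_at_infinity
            filterlim_tendsto_add_at_top[OF tendsto_const] filterlim_ident)
      have FTC: "(\<integral>\<^sup>+t. ennreal (1 / (1 + t)^2) * indicator {r..} t \<partial>lborel) = ennreal (1 / (1 + r))" if "r \<ge> 0" for r :: real
      proof (subst nn_integral_FTC_atLeast[where F="\<lambda>t. -1 / (1 + t)" and T=0])
        show "((\<lambda>t. - 1 / (1 + t)) has_real_derivative 1 / (1 + t)^2) (at t)" if "r \<le> t" for t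
          using that \<open>r \<ge> 0\<close>
          by (auto intro!: derivative_eq_intros simp: power2_eq_square field_simps)
      qed (use lim in auto)
      consider "c < 0" | "0 \<le> c" "c < 1" | "1 \<le> c" by linarith
      then show ?thesis
      proof cases
        case 1
        have "indicator {0..} t * indicator {c<..} (t / (1 + t)) = (indicator {0..} t :: ennreal)" for t :: real
        proof (cases "t \<ge> 0")
          case True
          then have "t / (1 + t) \<ge> 0" by simp
          then show ?thesis using 1 by (simp add: indicator_def)
        qed simp
        with FTC[of 0] 1 show ?thesis by simp
      next
        case 2
        \<comment> \<open>\<open>r\<close> solves \<open>r / (1 + r) = c\<close>, so that
          \<open>c < t / (1 + t)\<close> becomes \<open>r < t\<close>. The closed half-line in
          \<open>FTC\<close> adds the single null point \<open>r\<close>.\<close>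
        define r where "r = c / (1 - c)"
        have r: "r \<ge> 0" "1 / (1 + r) = 1 - c" using 2 by (auto simp: r_def field_simps)
        have ind: "t \<noteq> r \<longrightarrow> indicator {0..} t * indicator {c<..} (t / (1 + t)) = (indicator {r..} t :: ennreal)" for t
        proof (cases "t \<ge> 0")
          case True
          then have "c < t / (1 + t) \<longleftrightarrow> r < t" using 2 unfolding r_def by (simp add: field_simps)
          then show ?thesis using True by (auto simp: indicator_def)
        qed (use r in \<open>auto simp: indicator_def\<close>)
        have "(\<integral>\<^sup>+t. ennreal (1 / (1 + t)^2) * (indicator {0..} t * indicator {c<..} (t / (1 + t))) \<partial>lborel)
          = (\<integral>\<^sup>+t. ennreal (1 / (1 + t)^2) * indicator {r..} t \<partial>lborel)"
          using AE_lborel_singleton[of r] by (intro nn_integral_cong_AE) (auto simp: ind)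
        then show ?thesis using FTC[OF r(1)] r(2) 2 by simp
      next
        case 3
        have "indicator {0..} t * indicator {c<..} (t / (1 + t)) = (0 :: ennreal)" for t :: real
        proof (cases "t \<ge> 0")
          case True
          then have "t / (1 + t) < 1" by simp
          then show ?thesis using 3 by (simp add: indicator_def)
        qed simp
        then show ?thesis using 3 by (simp only: mult_zero_right) simp
      qed
    qed
    finally show ?thesis .
  qed
  show "emeasure (distr (iota 0) borel sphere_coord) {x<..} < \<infinity>" for x
    by (simp add: eq)
  fix c :: real
  have "emeasure (density lborel (indicator {0..1})) {c<..} = emeasure lborel ({0..1} \<inter> {c<..})"
    by (subst emeasure_density) (auto simp: indicator_inter_arith[symmetric])
  also have "\<dots> = (if c < 0 then 1 else if c < 1 then ennreal (1 - c) else 0)"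
  proof -
    have "{0..1} \<inter> {c<..} = (if c < 0 then {0..1} else if c < 1 then {c<..1} else {})" by auto
    then show ?thesis by simp
  qed
  finally show "emeasure (distr (iota 0) borel sphere_coord) {c<..} = emeasure (density lborel (indicator {0..1})) {c<..}"
    using eq by simp
qed auto

section \<open>Integration against \<open>iota\<close> by reduction to the probability measure
  \<open>iota 0\<close>\<close>

lemma measurable_iota [simp]: "borel_measurable (iota \<tau>) = borel_measurable borel"
  by (rule measurable_cong_sets) simp_all

lemma cnj_measurable [measurable]: "cnj \<in> borel_measurable borel"
  by (intro borel_measurable_continuous_onI continuous_intros)

lemma integral_iota_lborel:
  fixes g :: "complex \<Rightarrow> 'a::{banach, second_countable_topology}"
  assumes "g \<in> borel_measurable borel"
  shows "integral\<^sup>L (iota \<tau>) g = (LINT z|lborel. iota_dens \<tau> z *\<^sub>R g z)"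
    and "integrable (iota \<tau>) g \<longleftrightarrow> integrable lborel (\<lambda>z. iota_dens \<tau> z *\<^sub>R g z)"
  unfolding iota_def using assms by (simp_all add: integral_density integrable_density)

lemma AE_iota_nonzero: "AE z in iota \<tau>. z \<noteq> 0"
  unfolding iota_def using AE_lborel_singleton[of "0::complex"] by (subst AE_density) auto

lemma integral_iota_rotation:
  fixes g :: "complex \<Rightarrow> complex"
  assumes [measurable]: "g \<in> borel_measurable borel" and c: "cmod c = 1"
  shows "(LINT z|iota \<tau>. g (c * z)) = (LINT z|iota \<tau>. g z)"
proof -
  have dens: "iota_dens \<tau> (c * z) = iota_dens \<tau> z" for z
    using c by (simp add: iota_dens_def norm_mult)
  have "(LINT z|iota \<tau>. g z) = (LINT z|distr lborel borel (\<lambda>z. c * z). iota_dens \<tau> z *\<^sub>R g z)"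
    by (simp add: integral_iota_lborel distr_lborel_rotation[OF c])
  also have "\<dots> = (LINT z|lborel. iota_dens \<tau> z *\<^sub>R g (c * z))"
    by (subst integral_distr) (auto simp: dens)
  finally show ?thesis by (simp add: integral_iota_lborel)
qed

lemma emeasure_iota_0_UNIV: "emeasure (iota 0) UNIV = 1"
proof -
  have "emeasure (iota 0) UNIV = emeasure (distr (iota 0) borel sphere_coord) UNIV"
    by (subst emeasure_distr) auto
  also have "\<dots> = 1"
    unfolding distr_iota_sphere_coord by (subst emeasure_density) auto
  finally show ?thesis .
qed

lemma finite_measure_iota_0: "finite_measure (iota 0)"
  by (rule finite_measureI) (simp add: emeasure_iota_0_UNIV)

lemma iota_dens_eq: "iota_dens \<tau> z = iota_dens 0 z * ((real \<tau> + 1) / (1 + (cmod z)^2) ^ \<tau>)"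
  by (simp add: iota_dens_def)

text \<open>The measures \<open>iota \<tau>\<close> differ from \<open>iota 0\<close> by a weight
  only. Moving the weight into the integrand lets a single rotation invariant probability measure
  serve for all \<tau>.\<close>

lemma integral_iota_eq:
  fixes g :: "complex \<Rightarrow> complex"
  assumes [measurable]: "g \<in> borel_measurable borel"
  shows "(LINT z|iota \<tau>. g z) = of_nat (\<tau> + 1) * (LINT z|iota 0. g z / of_real ((1 + (cmod z)^2) ^ \<tau>))"
    and "integrable (iota \<tau>) g \<longleftrightarrow> integrable (iota 0) (\<lambda>z. g z / of_real ((1 + (cmod z)^2) ^ \<tau>))"
proof -
  have eq: "iota_dens \<tau> z *\<^sub>R g z = of_nat (\<tau> + 1) * (iota_dens 0 z *\<^sub>R (g z / of_real ((1 + (cmod z)^2) ^ \<tau>)))" for z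
    unfolding iota_dens_eq[of \<tau>] by (simp add: scaleR_conv_of_real field_simps)
  have [simp]: "of_nat (\<tau> + 1) \<noteq> (0::complex)" by (simp only: of_nat_eq_0_iff)
  show "(LINT z|iota \<tau>. g z) = of_nat (\<tau> + 1) * (LINT z|iota 0. g z / of_real ((1 + (cmod z)^2) ^ \<tau>))"
    by (simp only: integral_iota_lborel borel_measurable_divide borel_measurable_of_real assms eq integral_mult_right_zero)
       (subst integral_iota_lborel, auto)
  show "integrable (iota \<tau>) g \<longleftrightarrow> integrable (iota 0) (\<lambda>z. g z / of_real ((1 + (cmod z)^2) ^ \<tau>))"
  proof -
    have "integrable (iota \<tau>) g \<longleftrightarrow> integrable lborel
        (\<lambda>z. of_nat (\<tau> + 1) * (iota_dens 0 z *\<^sub>R (g z / of_real ((1 + (cmod z)^2) ^ \<tau>))))"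
      by (simp only: integral_iota_lborel(2)[OF assms] eq)
    also have "\<dots> \<longleftrightarrow> integrable lborel (\<lambda>z. iota_dens 0 z *\<^sub>R (g z / of_real ((1 + (cmod z)^2) ^ \<tau>)))"
    proof
      assume "integrable lborel
        (\<lambda>z. of_nat (\<tau> + 1) * (iota_dens 0 z *\<^sub>R (g z / of_real ((1 + (cmod z)^2) ^ \<tau>))))"
      from integrable_mult_right[OF this, of "inverse (of_nat (\<tau> + 1))"]
      show "integrable lborel (\<lambda>z. iota_dens 0 z *\<^sub>R (g z / of_real ((1 + (cmod z)^2) ^ \<tau>)))"
        by (simp add: mult.assoc[symmetric] del: of_nat_add of_nat_Suc)
    qed (rule integrable_mult_right)
    also have "\<dots> \<longleftrightarrow> integrable (iota 0) (\<lambda>z. g z / of_real ((1 + (cmod z)^2) ^ \<tau>))"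
      by (subst integral_iota_lborel(2)) simp_all
    finally show ?thesis .
  qed
qed

text \<open>Dividing by the weight leaves a bounded function on a finite measure space.\<close>

lemma integrable_iota_bound:
  fixes g :: "complex \<Rightarrow> complex"
  assumes [measurable]: "g \<in> borel_measurable borel"
    and bound: "\<And>z. cmod (g z) \<le> K * (1 + (cmod z)^2) ^ \<tau>"
  shows "integrable (iota \<tau>) g"
proof -
  interpret finite_measure "iota 0" by (rule finite_measure_iota_0)
  have "integrable (iota 0) (\<lambda>z. g z / of_real ((1 + (cmod z)^2) ^ \<tau>))"
  proof (rule integrable_const_bound[where B=K])
    show "AE z in iota 0. cmod (g z / of_real ((1 + (cmod z)^2) ^ \<tau>)) \<le> K"
      using bound by (auto simp: norm_divide norm_power divide_le_eq simp del: of_real_power of_real_add)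
  qed simp
  then show ?thesis by (subst integral_iota_eq) auto
qed

section \<open>Height and phase as coordinates on the sphere; orthogonality of monomials\<close>

lemma integral_iota_0_sphere_coord:
  fixes \<phi> :: "real \<Rightarrow> complex"
  assumes "continuous_on UNIV \<phi>"
  shows "(LINT z|iota 0. \<phi> (sphere_coord z)) = integral {0..1} \<phi>"
proof -
  have [measurable]: "\<phi> \<in> borel_measurable borel"
    using assms by (rule borel_measurable_continuous_onI)
  have "(LINT z|iota 0. \<phi> (sphere_coord z)) = (LINT x|distr (iota 0) borel sphere_coord. \<phi> x)"
    by (subst integral_distr) auto
  also have "\<dots> = (LINT x|density lborel (\<lambda>x. ennreal (indicator {0..1} x)). \<phi> x)"
    unfolding distr_iota_sphere_coord by (simp add: ennreal_indicator)
  also have "\<dots> = (LINT x:{0..1}|lborel. \<phi> x)"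
    unfolding set_lebesgue_integral_def by (subst integral_density) auto
  also have "\<dots> = integral {0..1} \<phi>"
    using assms by (intro set_borel_integral_eq_integral borel_integrable_atLeastAtMost')
      (auto intro: continuous_on_subset)
  finally show ?thesis .
qed

lemma sgn_power_int_measurable [measurable]:
  "(\<lambda>z::complex. sgn z powi d) \<in> borel_measurable borel"
  unfolding power_int_def sgn_div_norm by (cases "d \<ge> 0") simp_all

lemma integral_iota_polar:
  fixes \<phi> :: "real \<Rightarrow> complex"
  assumes \<phi>: "continuous_on UNIV \<phi>"
  shows "(LINT z|iota 0. \<phi> (sphere_coord z) * sgn z powi d) = (if d = 0 then integral {0..1} \<phi> else 0)"
proof (cases "d = 0")
  case True
  then show ?thesis by (simp add: integral_iota_0_sphere_coord[OF \<phi>])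
next
  case False
  have [measurable]: "\<phi> \<in> borel_measurable borel"
    using assms by (rule borel_measurable_continuous_onI)
  \<comment> \<open>Rotation by \<open>\<pi> / d\<close> preserves the measure and changes the sign of the integrand.\<close>
  define c where "c = cis (pi / real_of_int d)"
  have cd: "c powi d = -1"
    using False by (simp add: c_def cis_power_int cis_pi[symmetric] del: cis_pi)
  have nc: "cmod c = 1" by (simp add: c_def)
  have xc: "sphere_coord (c * z) = sphere_coord z" for z by (simp add: sphere_coord_def norm_mult nc)
  have sc: "sgn (c * z) powi d = - (sgn z powi d)" for z
    by (simp add: sgn_mult power_int_mult_distrib cd) (simp add: c_def sgn_eq cd[unfolded c_def])
  have "(LINT z|iota 0. \<phi> (sphere_coord z) * sgn z powi d) = (LINT z|iota 0. \<phi> (sphere_coord (c * z)) * sgn (c * z) powi d)"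
    by (rule integral_iota_rotation[OF _ nc, symmetric]) measurable
  also have "\<dots> = - (LINT z|iota 0. \<phi> (sphere_coord z) * sgn z powi d)"
    by (simp add: xc sc)
  finally show ?thesis using False by simp
qed

lemma sqrt_sphere_coord: "sqrt (sphere_coord z) = cmod z / sqrt (1 + (cmod z)^2)"
  by (simp add: sphere_coord_def real_sqrt_divide)

lemma sqrt_one_minus_sphere_coord: "sqrt (1 - sphere_coord z) = 1 / sqrt (1 + (cmod z)^2)"
proof -
  have "1 - sphere_coord z = 1 / (1 + (cmod z)^2)" by (simp add: sphere_coord_def field_simps)
  then show ?thesis by (simp add: real_sqrt_divide)
qed

text \<open>With \<open>z = cmod z * sgn z\<close>, conjugation inverts the phase. Of the
  \<open>m\<close> factors \<open>1 / sqrt (1 + (cmod z)^2)\<close>, \<open>p + q\<close> combine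
  with \<open>cmod z\<close> to \<open>sqrt (sphere_coord z)\<close>, and each of the others is
  \<open>sqrt (1 - sphere_coord z)\<close>. The case \<open>m = 2 * \<tau>\<close> serves the inner
  products, the case \<open>m = \<mu>\<close> the symbol.\<close>

lemma monomial_polar:
  fixes z :: complex
  assumes z: "z \<noteq> 0" and pq: "p + q \<le> m"
  shows "z ^ p * cnj z ^ q / of_real (sqrt (1 + (cmod z)^2) ^ m) =
     of_real (sqrt (sphere_coord z) ^ (p + q) * sqrt (1 - sphere_coord z) ^ (m - (p + q))) * sgn z powi (int p - int q)"
proof -
  define r s where "r = cmod z" and "s = sqrt (1 + (cmod z)^2)"
  have u: "sgn z \<noteq> 0" using z by (simp add: sgn_zero_iff)
  have uu: "cnj (sgn z) = inverse (sgn z)"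
    using z complex_norm_square[of "sgn z"] u by (simp add: norm_sgn field_simps)
  have zr: "z = of_real r * sgn z" using z by (simp add: r_def sgn_eq)
  have "z ^ p * cnj z ^ q = (of_real r * sgn z) ^ p * (of_real r * inverse (sgn z)) ^ q"
    by (metis zr uu complex_cnj_mult complex_cnj_complex_of_real)
  also have "\<dots> = of_real (r ^ (p + q)) * sgn z powi (int p - int q)"
    using u by (simp add: power_mult_distrib power_add power_int_diff power_inverse field_simps)
  finally have 1: "z ^ p * cnj z ^ q = of_real (r ^ (p + q)) * sgn z powi (int p - int q)" .
  have "sqrt (sphere_coord z) ^ (p + q) * sqrt (1 - sphere_coord z) ^ (m - (p + q)) = r ^ (p + q) / (s ^ (p + q) * s ^ (m - (p + q)))"
    by (simp add: sqrt_sphere_coord sqrt_one_minus_sphere_coord r_def s_def power_divide)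
  also have "s ^ (p + q) * s ^ (m - (p + q)) = s ^ m"
    using pq by (simp add: power_add[symmetric])
  finally have 2: "sqrt (sphere_coord z) ^ (p + q) * sqrt (1 - sphere_coord z) ^ (m - (p + q)) = r ^ (p + q) / sqrt (1 + (cmod z)^2) ^ m"
    by (simp add: s_def)
  show ?thesis unfolding 1 2 by simp
qed

lemma integral_power_mult_power:
  "((\<lambda>x::real. x ^ p * (1 - x) ^ m) has_integral (fact p * fact m / fact (p + m + 1))) {0..1}"
proof -
  have "((\<lambda>t::real. t powr (real (p + 1) - 1) * (1 - t) powr (real (m + 1) - 1)) has_integral
      Beta (real (p + 1)) (real (m + 1))) {0..1}"
    by (intro has_integral_Beta_real) auto
  moreover have "Beta (real (p + 1)) (real (m + 1)) = fact p * fact m / fact (p + m + 1)"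
    using Gamma_fact[of p, where 'a=real] Gamma_fact[of m, where 'a=real] Gamma_fact[of "p + m + 1", where 'a=real]
    by (simp add: Beta_def add_ac)
  \<comment> \<open>At the endpoints \<open>0 powr 0\<close> is 0 whereas \<open>0 ^ 0\<close> is 1,
    so the two integrands are compared only off \<open>{0, 1}\<close>.\<close>
  moreover have "t powr (real (p + 1) - 1) * (1 - t) powr (real (m + 1) - 1) = t ^ p * (1 - t) ^ m"
    if "t \<in> {0..1} - {0, 1}" for t :: real
    using that by (auto simp: powr_realpow)
  ultimately show ?thesis
    by (metis (no_types, lifting) has_integral_spike_finite finite.emptyI finite.insertI)
qed

text \<open>Both powers are at most \<open>sqrt (1 + (cmod z)^2) ^ \<tau>\<close>, since this root
  dominates 1 as well as \<open>cmod z\<close>.\<close>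

lemma cmod_monomial_le:
  assumes "p \<le> \<tau>" "q \<le> \<tau>"
  shows "cmod (z ^ p * cnj z ^ q) \<le> (1 + (cmod z)^2) ^ \<tau>"
proof -
  define s where "s = sqrt (1 + (cmod z)^2)"
  have s: "s \<ge> 1" "cmod z \<le> s" by (auto simp: s_def intro: real_le_rsqrt)
  have *: "cmod z ^ p \<le> s ^ \<tau>" if "p \<le> \<tau>" for p
    using s that by (meson power_mono power_increasing norm_ge_zero order_trans)
  have "cmod z ^ p * cmod z ^ q \<le> s ^ \<tau> * s ^ \<tau>"
    using s by (intro mult_mono * assms) auto
  also have "\<dots> = (s * s) ^ \<tau>" by (simp add: power_mult_distrib)
  also have "s * s = 1 + (cmod z)^2" by (simp add: s_def)
  finally show ?thesis by (simp add: norm_mult norm_power)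
qed

lemma integrable_iota_monomial:
  assumes "p \<le> \<tau>" "q \<le> \<tau>"
  shows "integrable (iota \<tau>) (\<lambda>z. z ^ p * cnj z ^ q)"
  using cmod_monomial_le[OF assms] by (intro integrable_iota_bound[where K=1]) simp_all

text \<open>The phase integrates to 0 unless \<open>p = q\<close>. In that case the Beta integral
  \<open>fact p * fact (\<tau> - p) / fact (\<tau> + 1)\<close> meets the factor
  \<open>\<tau> + 1\<close> of the density; this explains the root of a binomial coefficient in
  \<open>onb\<close>.\<close>

lemma integral_iota_monomial:
  assumes p: "p \<le> \<tau>" and q: "q \<le> \<tau>"
  shows "(LINT z|iota \<tau>. z ^ p * cnj z ^ q) = (if p = q then 1 / of_nat (\<tau> choose p) else 0)"
proof -
  define \<phi> where "\<phi> = (\<lambda>x::real. complex_of_real (sqrt x ^ (p + q) * sqrt (1 - x) ^ (2 * \<tau> - (p + q))))"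
  have \<phi>: "continuous_on UNIV \<phi>" unfolding \<phi>_def by (intro continuous_intros)
  have [measurable]: "\<phi> \<in> borel_measurable borel" using \<phi> by (rule borel_measurable_continuous_onI)
  have "(LINT z|iota \<tau>. z ^ p * cnj z ^ q) =
      of_nat (\<tau> + 1) * (LINT z|iota 0. z ^ p * cnj z ^ q / of_real ((1 + (cmod z)^2) ^ \<tau>))"
    by (rule integral_iota_eq) measurable
  also have "(LINT z|iota 0. z ^ p * cnj z ^ q / of_real ((1 + (cmod z)^2) ^ \<tau>)) =
      (LINT z|iota 0. \<phi> (sphere_coord z) * sgn z powi (int p - int q))"
  proof (rule integral_cong_AE)
    show "AE z in iota 0. z ^ p * cnj z ^ q / of_real ((1 + (cmod z)^2) ^ \<tau>) = \<phi> (sphere_coord z) * sgn z powi (int p - int q)"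
      using AE_iota_nonzero
    proof eventually_elim
      case (elim z)
      have "sqrt (1 + (cmod z)^2) ^ (2 * \<tau>) = (1 + (cmod z)^2) ^ \<tau>" by (simp add: power_mult)
      then show ?case using monomial_polar[OF elim, of p q "2 * \<tau>"] p q unfolding \<phi>_def by (simp only:)
    qed
  qed auto
  also have "\<dots> = (if p = q then integral {0..1} \<phi> else 0)"
    using integral_iota_polar[OF \<phi>, of "int p - int q"] by simp
  finally have *: "(LINT z|iota \<tau>. z ^ p * cnj z ^ q) = of_nat (\<tau> + 1) * (if p = q then integral {0..1} \<phi> else 0)" .
  show ?thesis
  proof (cases "p = q")
    case True
    have "((\<lambda>x. complex_of_real (x ^ p * (1 - x) ^ (\<tau> - p))) has_integral of_real (fact p * fact (\<tau> - p) / fact (p + (\<tau> - p) + 1))) {0..1}"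
      by (rule has_integral_of_real[OF integral_power_mult_power])
    moreover have "\<phi> x = complex_of_real (x ^ p * (1 - x) ^ (\<tau> - p))" if "x \<in> {0..1}" for x
    proof -
      have "sqrt x ^ (p + q) = x ^ p" using that True by (simp add: mult_2[symmetric] power_mult)
      moreover have "2 * \<tau> - (p + q) = 2 * (\<tau> - p)" using True by simp
      ultimately have "sqrt x ^ (p + q) * sqrt (1 - x) ^ (2 * \<tau> - (p + q)) = x ^ p * (1 - x) ^ (\<tau> - p)"
        using that by (simp add: power_mult)
      then show ?thesis unfolding \<phi>_def by (simp only:)
    qed
    ultimately have "(\<phi> has_integral of_real (fact p * fact (\<tau> - p) / fact (p + (\<tau> - p) + 1))) {0..1}"
      by (metis (no_types, lifting) has_integral_cong)
    then have int: "integral {0..1} \<phi> = of_real (fact p * fact (\<tau> - p) / fact (\<tau> + 1))"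
      using p by (simp add: integral_unique)
    have "real (\<tau> + 1) * (fact p * fact (\<tau> - p) / fact (\<tau> + 1)) = 1 / real (\<tau> choose p)"
    proof -
      have "fact (\<tau> + 1) = real (\<tau> + 1) * fact \<tau>" by simp
      then show ?thesis using p by (simp add: binomial_fact del: of_nat_add fact_Suc)
    qed
    then have "of_nat (\<tau> + 1) * integral {0..1} \<phi> = 1 / of_nat (\<tau> choose p)"
      unfolding int by (metis of_real_mult of_real_of_nat_eq of_real_divide of_real_1)
    then show ?thesis using * True by simp
  qed (use * in simp)
qed

lemma inner_H_onb:
  assumes "p \<le> \<tau>" "q \<le> \<tau>"
  shows "inner_H \<tau> (onb \<tau> p) (onb \<tau> q) = (if p = q then 1 else 0)"
proof -
  have "inner_H \<tau> (onb \<tau> p) (onb \<tau> q) =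
      (LINT z|iota \<tau>. of_real (sqrt (real (\<tau> choose p)) * sqrt (real (\<tau> choose q))) * (z ^ p * cnj z ^ q))"
    unfolding inner_H_def onb_def by (simp add: mult_ac)
  also have "\<dots> = of_real (sqrt (real (\<tau> choose p)) * sqrt (real (\<tau> choose q))) * (if p = q then 1 / of_nat (\<tau> choose p) else 0)"
    by (simp add: integral_iota_monomial[OF assms])
  also have "\<dots> = (if p = q then 1 else 0)"
  proof -
    have "complex_of_real (sqrt (real (\<tau> choose p))) * of_real (sqrt (real (\<tau> choose p))) = of_nat (\<tau> choose p)"
      by (simp flip: of_real_mult)
    then show ?thesis using assms by (auto simp: zero_less_binomial_iff)
  qed
  finally show ?thesis .
qed

section \<open>Matrix of the transfer operator\<close>

lemma integral_double_sum:
  fixes F :: "'i \<Rightarrow> 'j \<Rightarrow> 'a \<Rightarrow> complex"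
  assumes "\<And>i j. i \<in> I \<Longrightarrow> j \<in> J \<Longrightarrow> integrable M (F i j)"
  shows "(LINT p|M. (\<Sum>i\<in>I. \<Sum>j\<in>J. c i j * F i j p)) = (\<Sum>i\<in>I. \<Sum>j\<in>J. c i j * integral\<^sup>L M (F i j))"
proof -
  have "(LINT p|M. (\<Sum>i\<in>I. \<Sum>j\<in>J. c i j * F i j p)) = (\<Sum>i\<in>I. LINT p|M. (\<Sum>j\<in>J. c i j * F i j p))"
    using assms by (intro Bochner_Integration.integral_sum Bochner_Integration.integrable_sum integrable_mult_right)
  also have "\<dots> = (\<Sum>i\<in>I. \<Sum>j\<in>J. LINT p|M. c i j * F i j p)"
    using assms by (intro sum.cong refl Bochner_Integration.integral_sum integrable_mult_right)
  finally show ?thesis by simp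
qed

section \<open>The projection \<open>Pk\<close> in the orthonormal bases\<close>

lemma onb_measurable [measurable]: "onb \<tau> j \<in> borel_measurable borel"
  unfolding onb_def by measurable

lemma integrable_onb_monomial:
  assumes "p \<le> \<tau>" "q \<le> \<tau>"
  shows "integrable (iota \<tau>) (\<lambda>z. onb \<tau> p z * cnj z ^ q)"
  unfolding onb_def using integrable_iota_monomial[OF assms] by (simp add: mult.assoc)

lemma integral_onb_monomial:
  assumes "p \<le> \<tau>" "q \<le> \<tau>"
  shows "(LINT z|iota \<tau>. onb \<tau> p z * cnj z ^ q) = (if p = q then of_real (1 / sqrt (real (\<tau> choose p))) else 0)"
proof -
  have "(LINT z|iota \<tau>. onb \<tau> p z * cnj z ^ q) =
      of_real (sqrt (real (\<tau> choose p))) * (if p = q then 1 / of_nat (\<tau> choose p) else 0)"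
    unfolding onb_def using integral_iota_monomial[OF assms] by (simp add: mult.assoc)
  also have "\<dots> = (if p = q then of_real (1 / sqrt (real (\<tau> choose p))) else 0)"
  proof -
    have "sqrt (real (\<tau> choose p)) * (1 / real (\<tau> choose p)) = 1 / sqrt (real (\<tau> choose p))"
      using assms by (simp add: field_simps)
    then have "of_real (sqrt (real (\<tau> choose p))) * (1 / of_nat (\<tau> choose p)) = complex_of_real (1 / sqrt (real (\<tau> choose p)))"
      by (metis of_real_mult of_real_of_nat_eq of_real_divide of_real_1)
    then show ?thesis by auto
  qed
  finally show ?thesis .
qed

lemma integrable_onb_onb:
  assumes "p \<le> \<tau>" "q \<le> \<tau>"
  shows "integrable (iota \<tau>) (\<lambda>z. onb \<tau> p z * cnj (onb \<tau> q z))"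
proof -
  have "onb \<tau> p z * cnj (onb \<tau> q z) = of_real (sqrt (real (\<tau> choose q))) * (onb \<tau> p z * cnj z ^ q)" for z
    by (simp add: onb_def mult_ac)
  then show ?thesis using integrable_onb_monomial[OF assms] by (simp only: integrable_mult_right)
qed

lemma inner_H_sum_onb:
  assumes "m \<le> \<tau>"
  shows "inner_H \<tau> (\<lambda>\<xi>. \<Sum>j\<le>\<tau>. c j * onb \<tau> j \<xi>) (\<lambda>\<xi>. \<gamma> * onb \<tau> m \<xi>) = c m * cnj \<gamma>"
proof -
  have "inner_H \<tau> (\<lambda>\<xi>. \<Sum>j\<le>\<tau>. c j * onb \<tau> j \<xi>) (\<lambda>\<xi>. \<gamma> * onb \<tau> m \<xi>) =
      (LINT z|iota \<tau>. (\<Sum>j\<le>\<tau>. (c j * cnj \<gamma>) * (onb \<tau> j z * cnj (onb \<tau> m z))))"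
    unfolding inner_H_def by (simp add: sum_distrib_left sum_distrib_right mult_ac)
  also have "\<dots> = (\<Sum>j\<le>\<tau>. (c j * cnj \<gamma>) * inner_H \<tau> (onb \<tau> j) (onb \<tau> m))"
    unfolding inner_H_def
    by (subst Bochner_Integration.integral_sum)
       (auto intro!: sum.cong integrable_mult_right integrable_onb_onb assms)
  also have "\<dots> = (\<Sum>j\<le>\<tau>. if j = m then c j * cnj \<gamma> else 0)"
    by (intro sum.cong refl) (simp add: inner_H_onb assms)
  also have "\<dots> = c m * cnj \<gamma>" using assms by simp
  finally show ?thesis .
qed

lemma sigma_finite_iota: "sigma_finite_measure (iota \<tau>)"
  unfolding iota_def
  by (subst sigma_finite_measure.sigma_finite_iff_density_finite[OF sigma_finite_lborel]) auto

lemma integral_iota_pair: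
  fixes g h :: "complex \<Rightarrow> complex"
  assumes g: "integrable (iota \<mu>) g" and h: "integrable (iota \<nu>) h"
  shows "integrable (iota \<mu> \<Otimes>\<^sub>M iota \<nu>) (\<lambda>p. g (fst p) * h (snd p))"
    and "(LINT p|(iota \<mu> \<Otimes>\<^sub>M iota \<nu>). g (fst p) * h (snd p)) = (LINT z|iota \<mu>. g z) * (LINT w|iota \<nu>. h w)"
proof -
  interpret pair_sigma_finite "iota \<mu>" "iota \<nu>"
    by (intro pair_sigma_finite.intro sigma_finite_iota)
  have [measurable]: "g \<in> borel_measurable (iota \<mu>)" "h \<in> borel_measurable (iota \<nu>)"
    using g h by (auto dest: borel_measurable_integrable)
  show *: "integrable (iota \<mu> \<Otimes>\<^sub>M iota \<nu>) (\<lambda>p. g (fst p) * h (snd p))"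
  proof (rule Fubini_integrable)
    show "integrable (iota \<mu>) (\<lambda>x. LINT y|iota \<nu>. cmod (g (fst (x, y)) * h (snd (x, y))))"
      using g by (simp add: norm_mult)
  qed (use h in auto)
  show "(LINT p|(iota \<mu> \<Otimes>\<^sub>M iota \<nu>). g (fst p) * h (snd p)) = (LINT z|iota \<mu>. g z) * (LINT w|iota \<nu>. h w)"
    using integral_fst'[OF *] by simp
qed

text \<open>
  The factor \<open>(\<nu>-k choose t) / sqrt ((\<nu> choose b) * (\<mu>+\<nu>-2k choose t+s))\<close> with \<open>t = b - (k - i)\<close>,
  split into two roots because each quotient is at most 1 and has an explicit limit.
\<close>

definition clebsch_gordan_ratio :: "nat \<Rightarrow> nat \<Rightarrow> nat \<Rightarrow> nat \<Rightarrow> nat \<Rightarrow> nat \<Rightarrow> real" where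
  "clebsch_gordan_ratio \<mu> \<nu> k i s b = (if k - i \<le> b then
     sqrt (real (\<nu> - k choose (b - (k - i))) / real (\<nu> choose b)) *
     sqrt (real (\<nu> - k choose (b - (k - i))) / real (\<mu> + \<nu> - 2 * k choose (b - (k - i) + s)))
   else 0)"

text \<open>In the integrand of \<open>Jk\<close>, \<open>i\<close> counts the factors
  \<open>cnj z\<close> taken from \<open>(cnj z - cnj w) ^ k\<close> and \<open>s\<close> those
  taken from the power with exponent \<open>\<mu> - k\<close>; pairing with \<open>z ^ a\<close>
  forces \<open>i + s = a\<close>. The number of factors \<open>cnj w\<close> taken from the last
  power is then fixed by \<open>b\<close>, which leaves only a double sum.\<close>

definition clebsch_gordan :: "nat \<Rightarrow> nat \<Rightarrow> nat \<Rightarrow> nat \<Rightarrow> nat \<Rightarrow> real" where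
  "clebsch_gordan \<mu> \<nu> k a b = Cmnk \<mu> \<nu> k / sqrt (real (\<mu> choose a)) *
     (\<Sum>i\<le>k. \<Sum>s\<le>\<mu> - k. if i + s = a then
        (-1) ^ (k - i) * real (k choose i) * real (\<mu> - k choose s) * clebsch_gordan_ratio \<mu> \<nu> k i s b else 0)"

text \<open>If \<open>a + b < k\<close>, then \<open>b < k - i\<close> in every term; if
  \<open>a + b > \<mu> + \<nu> - k\<close>, then \<open>b - (k - i)\<close> exceeds
  \<open>\<nu> - k\<close> and the binomial coefficient is 0. This vanishing is what makes the
  truncated index \<open>a + b - k\<close> harmless.\<close>

lemma clebsch_gordan_eq_0:
  assumes "k \<le> \<mu>" "k \<le> \<nu>" "\<not> (k \<le> a + b \<and> a + b \<le> \<mu> + \<nu> - k)"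
  shows "clebsch_gordan \<mu> \<nu> k a b = 0"
proof -
  have "clebsch_gordan_ratio \<mu> \<nu> k i s b = 0" if "i \<le> k" "s \<le> \<mu> - k" "i + s = a" for i s
    using assms that by (auto simp: clebsch_gordan_ratio_def)
  then show ?thesis
    unfolding clebsch_gordan_def by (intro mult_eq_0_iff[THEN iffD2] disjI2 sum.neutral ballI) auto
qed

text \<open>Three binomial expansions turn the integrand into a sum of products of a function of
  \<open>z\<close> and a function of \<open>w\<close>. Orthogonality of monomials keeps only the
  terms with \<open>a = i + s\<close> and \<open>b = k - i + t\<close>.\<close>

lemma Jk_integrand_onb:
  assumes k: "k \<le> \<mu>" "k \<le> \<nu>" and a: "a \<le> \<mu>" and b: "b \<le> \<nu>"
  defines "F \<equiv> \<lambda>\<xi> p. onb \<mu> a (fst p) * onb \<nu> b (snd p) * (cnj (fst p) - cnj (snd p)) ^ k *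
      (1 + \<xi> * cnj (fst p)) ^ (\<mu> - k) * (1 + \<xi> * cnj (snd p)) ^ (\<nu> - k)"
  shows "integrable (iota \<mu> \<Otimes>\<^sub>M iota \<nu>) (F \<xi>)" (is ?int)
    and "of_real (Cmnk \<mu> \<nu> k) * integral\<^sup>L (iota \<mu> \<Otimes>\<^sub>M iota \<nu>) (F \<xi>) =
      of_real (clebsch_gordan \<mu> \<nu> k a b) * onb (\<mu> + \<nu> - 2 * k) (a + b - k) \<xi>" (is ?eq)
proof -
  define C where "C = (\<lambda>i s t. (-1) ^ (k - i) * of_nat (k choose i) * of_nat (\<mu> - k choose s) * of_nat (\<nu> - k choose t) * \<xi> ^ (s + t) :: complex)"
  define G where "G = (\<lambda>i s t p. (onb \<mu> a (fst p) * cnj (fst p) ^ (i + s)) * (onb \<nu> b (snd p) * cnj (snd p) ^ (k - i + t)))"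
  have F: "F \<xi> = (\<lambda>p. \<Sum>i\<le>k. \<Sum>s\<le>\<mu> - k. \<Sum>t\<le>\<nu> - k. C i s t * G i s t p)"
  proof
    fix p :: "complex \<times> complex"
    have 1: "(cnj (fst p) - cnj (snd p)) ^ k = (\<Sum>i\<le>k. of_nat (k choose i) * cnj (fst p) ^ i * (- cnj (snd p)) ^ (k - i))"
      using binomial_ring[of "cnj (fst p)" "- cnj (snd p)" k] by simp
    have 2: "(1 + \<xi> * cnj w) ^ m = (\<Sum>s\<le>m. of_nat (m choose s) * (\<xi> * cnj w) ^ s)" for w m
      using binomial_ring[of "\<xi> * cnj w" 1 m] by (simp add: add.commute)
    show "F \<xi> p = (\<Sum>i\<le>k. \<Sum>s\<le>\<mu> - k. \<Sum>t\<le>\<nu> - k. C i s t * G i s t p)"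
      unfolding F_def 1 2 sum_distrib_left sum_distrib_right
      by (subst sum.swap, subst (2) sum.swap, subst sum.swap)
         (intro sum.cong refl, auto simp: C_def G_def power_mult_distrib power_add power_minus[of "cnj (snd p)"] mult_ac)
  qed
  have GI: "integrable (iota \<mu> \<Otimes>\<^sub>M iota \<nu>) (G i s t)"
    and G: "integral\<^sup>L (iota \<mu> \<Otimes>\<^sub>M iota \<nu>) (G i s t) =
      (if a = i + s \<and> b = k - i + t then of_real (1 / sqrt (real (\<mu> choose a)) * (1 / sqrt (real (\<nu> choose b)))) else 0)"
    if "i \<le> k" "s \<le> \<mu> - k" "t \<le> \<nu> - k" for i s t
  proof -
    have le: "i + s \<le> \<mu>" "k - i + t \<le> \<nu>" using that k by auto
    note 1 = integrable_onb_monomial[OF a le(1)] integrable_onb_monomial[OF b le(2)]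
    show "integrable (iota \<mu> \<Otimes>\<^sub>M iota \<nu>) (G i s t)"
      unfolding G_def using integral_iota_pair(1)[OF 1] .
    show "integral\<^sup>L (iota \<mu> \<Otimes>\<^sub>M iota \<nu>) (G i s t) =
      (if a = i + s \<and> b = k - i + t then of_real (1 / sqrt (real (\<mu> choose a)) * (1 / sqrt (real (\<nu> choose b)))) else 0)"
      unfolding G_def integral_iota_pair(2)[OF 1] integral_onb_monomial[OF a le(1)] integral_onb_monomial[OF b le(2)]
      by simp
  qed
  show ?int unfolding F
    by (intro Bochner_Integration.integrable_sum integrable_mult_right GI) auto
  define N j where "N = \<mu> + \<nu> - 2 * k" and "j = a + b - k"
  have t_sum: "(\<Sum>t\<le>\<nu> - k. C i s t * (if a = i + s \<and> b = k - i + t then of_real (1 / sqrt (real (\<mu> choose a)) * (1 / sqrt (real (\<nu> choose b)))) else 0))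
      = (if i + s = a then of_real (1 / sqrt (real (\<mu> choose a)) * ((-1) ^ (k - i) * real (k choose i) * real (\<mu> - k choose s) * clebsch_gordan_ratio \<mu> \<nu> k i s b)) * onb N j \<xi> else 0)"
    if "i \<le> k" "s \<le> \<mu> - k" for i s
  proof (cases "i + s = a \<and> k - i \<le> b \<and> b - (k - i) \<le> \<nu> - k")
    case True
    define t where "t = b - (k - i)"
    have t: "t \<le> \<nu> - k" "b = k - i + t" "j = s + t" "t + s \<le> N"
      using True that k by (auto simp: t_def j_def N_def)
    define A where "A = sqrt (real (\<nu> - k choose t))"
    define D where "D = sqrt (real (N choose (t + s)))"
    have D: "D > 0" using t(4) by (simp add: D_def)
    have A: "A * A = real (\<nu> - k choose t)" by (simp add: A_def)
    \<comment> \<open>\<open>D\<close> is the normalisation of \<open>onb N j\<close>. Splitting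
      \<open>\<nu> - k choose t\<close> as \<open>A * A\<close> provides one numerator for each of
      the two roots of the ratio.\<close>
    have rt: "clebsch_gordan_ratio \<mu> \<nu> k i s b * D = real (\<nu> - k choose t) / sqrt (real (\<nu> choose b))"
    proof -
      have "clebsch_gordan_ratio \<mu> \<nu> k i s b = A / sqrt (real (\<nu> choose b)) * (A / D)"
        using True by (simp add: clebsch_gordan_ratio_def t_def[symmetric] real_sqrt_divide A_def D_def N_def)
      then show ?thesis using D by (simp add: A[symmetric])
    qed
    have "(\<Sum>t\<le>\<nu> - k. C i s t * (if a = i + s \<and> b = k - i + t then of_real (1 / sqrt (real (\<mu> choose a)) * (1 / sqrt (real (\<nu> choose b)))) else 0))
      = (\<Sum>t'\<le>\<nu> - k. if t' = t then C i s t * of_real (1 / sqrt (real (\<mu> choose a)) * (1 / sqrt (real (\<nu> choose b)))) else 0)"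
      using True t by (intro sum.cong) auto
    also have "\<dots> = C i s t * of_real (1 / sqrt (real (\<mu> choose a)) * (1 / sqrt (real (\<nu> choose b))))"
      using t by simp
    also have "\<dots> = of_real (1 / sqrt (real (\<mu> choose a)) * ((-1) ^ (k - i) * real (k choose i) * real (\<mu> - k choose s)
        * (real (\<nu> - k choose t) / sqrt (real (\<nu> choose b))))) * \<xi> ^ (s + t)"
      by (simp add: C_def)
    also have "\<dots> = of_real (1 / sqrt (real (\<mu> choose a)) * ((-1) ^ (k - i) * real (k choose i) * real (\<mu> - k choose s) * clebsch_gordan_ratio \<mu> \<nu> k i s b)) * onb N j \<xi>"
      unfolding rt[symmetric] onb_def t(3) by (simp add: D_def add.commute)
    finally show ?thesis using True by simp
  next
    case False
    then have z: "C i s t * (if a = i + s \<and> b = k - i + t then of_real (1 / sqrt (real (\<mu> choose a)) * (1 / sqrt (real (\<nu> choose b)))) else 0) = 0"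
      if "t \<le> \<nu> - k" for t using that by auto
    \<comment> \<open>There are two ways to vanish: the default 0 when \<open>b < k - i\<close>, and
      a binomial coefficient whose lower index exceeds \<open>\<nu> - k\<close>.\<close>
    have "clebsch_gordan_ratio \<mu> \<nu> k i s b = 0" if "i + s = a"
      using that False by (auto simp: clebsch_gordan_ratio_def binomial_eq_0)
    then show ?thesis using z by (simp add: sum.neutral)
  qed
  have "integral\<^sup>L (iota \<mu> \<Otimes>\<^sub>M iota \<nu>) (F \<xi>) =
      (\<Sum>i\<le>k. \<Sum>s\<le>\<mu> - k. \<Sum>t\<le>\<nu> - k. C i s t * integral\<^sup>L (iota \<mu> \<Otimes>\<^sub>M iota \<nu>) (G i s t))"
  proof -
    have "integrable (iota \<mu> \<Otimes>\<^sub>M iota \<nu>) (\<lambda>p. \<Sum>t\<le>\<nu> - k. C i s t * G i s t p)" if "i \<in> {..k}" "s \<in> {..\<mu> - k}" for i s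
      using that by (intro Bochner_Integration.integrable_sum integrable_mult_right GI) auto
    from integral_double_sum[OF this, where c="\<lambda>_ _. 1"]
    have "integral\<^sup>L (iota \<mu> \<Otimes>\<^sub>M iota \<nu>) (F \<xi>) =
        (\<Sum>i\<le>k. \<Sum>s\<le>\<mu> - k. LINT p|(iota \<mu> \<Otimes>\<^sub>M iota \<nu>). (\<Sum>t\<le>\<nu> - k. C i s t * G i s t p))"
      unfolding F by (simp only: mult_1)
    also have "\<dots> = (\<Sum>i\<le>k. \<Sum>s\<le>\<mu> - k. \<Sum>t\<le>\<nu> - k. C i s t * integral\<^sup>L (iota \<mu> \<Otimes>\<^sub>M iota \<nu>) (G i s t))"
      by (intro sum.cong refl) (simp add: GI)
    finally show ?thesis .
  qed
  also have "\<dots> = (\<Sum>i\<le>k. \<Sum>s\<le>\<mu> - k. if i + s = a then of_real (1 / sqrt (real (\<mu> choose a)) * ((-1) ^ (k - i) * real (k choose i) * real (\<mu> - k choose s) * clebsch_gordan_ratio \<mu> \<nu> k i s b)) * onb N j \<xi> else 0)"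
    by (intro sum.cong refl) (subst t_sum[symmetric], auto intro!: sum.cong simp: G)
  also have "of_real (Cmnk \<mu> \<nu> k) * \<dots> = of_real (clebsch_gordan \<mu> \<nu> k a b) * onb N j \<xi>"
    unfolding clebsch_gordan_def of_real_mult of_real_sum sum_distrib_left sum_distrib_right
    by (intro sum.cong refl) simp
  finally show ?eq unfolding N_def j_def .
qed

lemma Pk_sum_onb:
  assumes k: "k \<le> \<mu>" "k \<le> \<nu>"
  shows "Pk \<mu> \<nu> k (\<lambda>z w. \<Sum>a\<le>\<mu>. \<Sum>b\<le>\<nu>. c a b * (onb \<mu> a z * onb \<nu> b w)) =
    (\<lambda>\<xi>. \<Sum>a\<le>\<mu>. \<Sum>b\<le>\<nu>. c a b * of_real (clebsch_gordan \<mu> \<nu> k a b) * onb (\<mu> + \<nu> - 2 * k) (a + b - k) \<xi>)"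
proof
  fix \<xi>
  define F where "F = (\<lambda>a b p. onb \<mu> a (fst p) * onb \<nu> b (snd p) * (cnj (fst p) - cnj (snd p)) ^ k *
      (1 + \<xi> * cnj (fst p)) ^ (\<mu> - k) * (1 + \<xi> * cnj (snd p)) ^ (\<nu> - k))"
  have int: "integrable (iota \<mu> \<Otimes>\<^sub>M iota \<nu>) (F a b)" if "a \<le> \<mu>" "b \<le> \<nu>" for a b
    using Jk_integrand_onb(1)[OF k that, of \<xi>] by (simp add: F_def)
  have eq: "of_real (Cmnk \<mu> \<nu> k) * integral\<^sup>L (iota \<mu> \<Otimes>\<^sub>M iota \<nu>) (F a b) =
      of_real (clebsch_gordan \<mu> \<nu> k a b) * onb (\<mu> + \<nu> - 2 * k) (a + b - k) \<xi>" if "a \<le> \<mu>" "b \<le> \<nu>" for a b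
    using Jk_integrand_onb(2)[OF k that, of \<xi>] by (simp add: F_def)
  have "Pk \<mu> \<nu> k (\<lambda>z w. \<Sum>a\<le>\<mu>. \<Sum>b\<le>\<nu>. c a b * (onb \<mu> a z * onb \<nu> b w)) \<xi> =
     of_real (Cmnk \<mu> \<nu> k) * (LINT p|(iota \<mu> \<Otimes>\<^sub>M iota \<nu>). (\<Sum>a\<le>\<mu>. \<Sum>b\<le>\<nu>. c a b * F a b p))"
    by (simp add: Pk_def Jk_def F_def sum_distrib_right mult.assoc)
  also have "\<dots> = of_real (Cmnk \<mu> \<nu> k) * (\<Sum>a\<le>\<mu>. \<Sum>b\<le>\<nu>. c a b * integral\<^sup>L (iota \<mu> \<Otimes>\<^sub>M iota \<nu>) (F a b))"
    by (subst integral_double_sum) (simp_all add: int)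
  also have "\<dots> = (\<Sum>a\<le>\<mu>. \<Sum>b\<le>\<nu>. c a b * (of_real (Cmnk \<mu> \<nu> k) * integral\<^sup>L (iota \<mu> \<Otimes>\<^sub>M iota \<nu>) (F a b)))"
    by (simp add: sum_distrib_left mult_ac)
  also have "\<dots> = (\<Sum>a\<le>\<mu>. \<Sum>b\<le>\<nu>. c a b * of_real (clebsch_gordan \<mu> \<nu> k a b) * onb (\<mu> + \<nu> - 2 * k) (a + b - k) \<xi>)"
    by (intro sum.cong refl) (simp add: eq mult.assoc)
  finally show "Pk \<mu> \<nu> k (\<lambda>z w. \<Sum>a\<le>\<mu>. \<Sum>b\<le>\<nu>. c a b * (onb \<mu> a z * onb \<nu> b w)) \<xi> =
    (\<Sum>a\<le>\<mu>. \<Sum>b\<le>\<nu>. c a b * of_real (clebsch_gordan \<mu> \<nu> k a b) * onb (\<mu> + \<nu> - 2 * k) (a + b - k) \<xi>)" .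
qed

lemma Pk_onb:
  assumes k: "k \<le> \<mu>" "k \<le> \<nu>" and a: "a \<le> \<mu>" and b: "b \<le> \<nu>"
  shows "Pk \<mu> \<nu> k (\<lambda>z w. onb \<mu> a z * onb \<nu> b w) =
    (\<lambda>\<xi>. of_real (clebsch_gordan \<mu> \<nu> k a b) * onb (\<mu> + \<nu> - 2 * k) (a + b - k) \<xi>)"
  using Jk_integrand_onb(2)[OF assms] by (simp add: Pk_def Jk_def)

section \<open>The Toeplitz operator \<open>Rstar\<close> as a matrix\<close>

definition Rstar_matrix :: "nat \<Rightarrow> (complex \<Rightarrow> complex) \<Rightarrow> nat \<Rightarrow> nat \<Rightarrow> complex" where
  "Rstar_matrix \<mu> f a a' = 1 / (of_nat \<mu> + 1) * (LINT z|iota \<mu>. f z * (onb \<mu> a' z * cnj (onb \<mu> a z)))"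

lemma cont_CP1_measurable: "cont_CP1 f \<Longrightarrow> f \<in> borel_measurable borel"
  by (auto simp: cont_CP1_def intro: borel_measurable_continuous_onI)

text \<open>Near infinity \<open>f\<close> stays within distance 1 of its limit, and what remains is
  a compact disc.\<close>

lemma cont_CP1_bounded:
  assumes "cont_CP1 f"
  obtains K where "K > 0" "\<And>z. cmod (f z) \<le> K"
proof -
  from assms obtain L where cont: "continuous_on UNIV f" and L: "(f \<longlongrightarrow> L) at_infinity"
    by (auto simp: cont_CP1_def)
  have "eventually (\<lambda>z. dist (f z) L < 1) at_infinity"
    using tendstoD[OF L, of 1] by simp
  then obtain r where r: "\<And>z. r \<le> cmod z \<Longrightarrow> dist (f z) L < 1"
    by (auto simp: eventually_at_infinity)
  have "bounded (f ` cball 0 r)"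
    by (intro compact_imp_bounded compact_continuous_image continuous_on_subset[OF cont]) auto
  then obtain B where B: "\<And>z. z \<in> cball 0 r \<Longrightarrow> cmod (f z) \<le> B"
    unfolding bounded_iff by blast
  have "cmod (f z) \<le> \<bar>B\<bar> + cmod L + 1" for z
  proof (cases "cmod z \<le> r")
    case True
    then have "cmod (f z) \<le> B" using B by simp
    then show ?thesis by (smt (verit) norm_ge_zero)
  next
    case False
    then have "cmod (f z - L) < 1" using r[of z] by (simp add: dist_norm)
    then show ?thesis using norm_triangle_sub[of "f z" L] by linarith
  qed
  moreover have "\<bar>B\<bar> + cmod L + 1 > 0" by (smt (verit) norm_ge_zero)
  ultimately show thesis using that by blast
qed

lemma integrable_cont_CP1_mult:
  fixes g :: "complex \<Rightarrow> complex"
  assumes f: "cont_CP1 f" and g: "integrable (iota \<tau>) g"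
  shows "integrable (iota \<tau>) (\<lambda>z. f z * g z)"
proof -
  obtain K where K: "\<And>z. cmod (f z) \<le> K" using cont_CP1_bounded[OF f] by metis
  have [measurable]: "f \<in> borel_measurable borel" "g \<in> borel_measurable borel"
    using cont_CP1_measurable[OF f] borel_measurable_integrable[OF g] by simp_all
  show ?thesis
  proof (rule Bochner_Integration.integrable_bound)
    show "integrable (iota \<tau>) (\<lambda>z. of_real K * g z)" using g by simp
    show "AE z in iota \<tau>. cmod (f z * g z) \<le> cmod (of_real K * g z)"
      using K by (intro AE_I2) (auto simp: norm_mult intro!: mult_right_mono intro: order_trans[OF K])
  qed simp
qed

text \<open>\<open>(1 + x * cnj z) ^ \<mu>\<close> is the reproducing kernel of
  \<open>H \<mu>\<close>, the sum of all \<open>onb \<mu> a x * cnj (onb \<mu> a z)\<close>. So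
  \<open>Rstar\<close> multiplies by \<open>f\<close>, projects orthogonally and divides by
  \<open>\<mu> + 1\<close>.\<close>

lemma Rstar_sum_onb:
  assumes f: "cont_CP1 f"
  shows "Rstar \<mu> f (\<lambda>z. \<Sum>a'\<le>\<mu>. c a' * onb \<mu> a' z) =
    (\<lambda>x. \<Sum>a\<le>\<mu>. (\<Sum>a'\<le>\<mu>. Rstar_matrix \<mu> f a a' * c a') * onb \<mu> a x)"
proof
  fix x
  have kernel: "(1 + x * cnj z) ^ \<mu> = (\<Sum>a\<le>\<mu>. onb \<mu> a x * cnj (onb \<mu> a z))" for z
  proof -
    have "(1 + x * cnj z) ^ \<mu> = (\<Sum>a\<le>\<mu>. of_nat (\<mu> choose a) * (x * cnj z) ^ a)"
      using binomial_ring[of "x * cnj z" 1 \<mu>] by (simp add: add.commute)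
    also have "\<dots> = (\<Sum>a\<le>\<mu>. onb \<mu> a x * cnj (onb \<mu> a z))"
    proof (intro sum.cong refl)
      fix a
      have "complex_of_real (sqrt (real (\<mu> choose a))) * of_real (sqrt (real (\<mu> choose a))) = of_nat (\<mu> choose a)"
        by (simp flip: of_real_mult)
      then show "of_nat (\<mu> choose a) * (x * cnj z) ^ a = onb \<mu> a x * cnj (onb \<mu> a z)"
        by (simp add: onb_def power_mult_distrib mult_ac)
    qed
    finally show ?thesis .
  qed
  have "Rstar \<mu> f (\<lambda>z. \<Sum>a'\<le>\<mu>. c a' * onb \<mu> a' z) x = 1 / (of_nat \<mu> + 1) *
      (LINT z|iota \<mu>. (\<Sum>a\<le>\<mu>. \<Sum>a'\<le>\<mu>. (c a' * onb \<mu> a x) * (f z * (onb \<mu> a' z * cnj (onb \<mu> a z)))))"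
    unfolding Rstar_def kernel
  proof (intro arg_cong2[where f="(*)"] refl Bochner_Integration.integral_cong)
    fix z
    show "f z * (\<Sum>a'\<le>\<mu>. c a' * onb \<mu> a' z) * (\<Sum>a\<le>\<mu>. onb \<mu> a x * cnj (onb \<mu> a z)) =
      (\<Sum>a\<le>\<mu>. \<Sum>a'\<le>\<mu>. (c a' * onb \<mu> a x) * (f z * (onb \<mu> a' z * cnj (onb \<mu> a z))))"
      unfolding sum_distrib_left sum_distrib_right by (simp add: mult_ac)
  qed
  also have "\<dots> = 1 / (of_nat \<mu> + 1) *
      (\<Sum>a\<le>\<mu>. \<Sum>a'\<le>\<mu>. (c a' * onb \<mu> a x) * (LINT z|iota \<mu>. f z * (onb \<mu> a' z * cnj (onb \<mu> a z))))"
    by (subst integral_double_sum) (auto intro!: integrable_cont_CP1_mult[OF f] integrable_onb_onb)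
  also have "\<dots> = (\<Sum>a\<le>\<mu>. (\<Sum>a'\<le>\<mu>. Rstar_matrix \<mu> f a a' * c a') * onb \<mu> a x)"
    unfolding sum_distrib_left sum_distrib_right Rstar_matrix_def by (intro sum.cong refl) (simp add: mult_ac)
  finally show "Rstar \<mu> f (\<lambda>z. \<Sum>a'\<le>\<mu>. c a' * onb \<mu> a' z) x =
    (\<Sum>a\<le>\<mu>. (\<Sum>a'\<le>\<mu>. Rstar_matrix \<mu> f a a' * c a') * onb \<mu> a x)" .
qed

section \<open>The matrix of \<open>Tmap\<close> and of its powers\<close>

text \<open>Tensoring with the identity leaves \<open>b\<close> alone, so \<open>b\<close> links row
  \<open>i\<close> to column \<open>j\<close>. The constraints are additive because the truncated
  difference \<open>a + b - k\<close> would also send every \<open>a + b < k\<close> to index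
  0.\<close>

definition transfer_matrix :: "nat \<Rightarrow> nat \<Rightarrow> nat \<Rightarrow> (nat \<Rightarrow> nat \<Rightarrow> complex) \<Rightarrow> nat \<Rightarrow> nat \<Rightarrow> complex" where
  "transfer_matrix \<mu> \<nu> k A i j = (\<Sum>a\<le>\<mu>. \<Sum>b\<le>\<nu>. \<Sum>a'\<le>\<mu>. if a + b = i + k \<and> a' + b = j + k
     then A a a' * of_real (clebsch_gordan \<mu> \<nu> k a b * clebsch_gordan \<mu> \<nu> k a' b) else 0)"

lemma sum_swap_double:
  "(\<Sum>i\<in>I. \<Sum>j\<in>J. \<Sum>a\<in>A. h i j a) = (\<Sum>a\<in>A. \<Sum>i\<in>I. \<Sum>j\<in>J. h i j a)"
proof -
  have "(\<Sum>i\<in>I. \<Sum>j\<in>J. \<Sum>a\<in>A. h i j a) = (\<Sum>i\<in>I. \<Sum>a\<in>A. \<Sum>j\<in>J. h i j a)"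
    by (intro sum.cong refl sum.swap)
  also have "\<dots> = (\<Sum>a\<in>A. \<Sum>i\<in>I. \<Sum>j\<in>J. h i j a)"
    by (rule sum.swap)
  finally show ?thesis .
qed

text \<open>The adjoint has the conjugate transposed matrix, and the conjugation is invisible
  because the Clebsch-Gordan coefficients are real.\<close>

lemma Pk_adj_sum_onb:
  fixes \<mu> \<nu> k :: nat and c :: "nat \<Rightarrow> complex"
  assumes k: "k \<le> \<mu>" "k \<le> \<nu>"
  defines "N \<equiv> \<mu> + \<nu> - 2 * k"
  shows "Pk_adj \<mu> \<nu> k (\<lambda>\<xi>. \<Sum>j\<le>N. c j * onb N j \<xi>) =
    (\<lambda>z w. \<Sum>a\<le>\<mu>. \<Sum>b\<le>\<nu>. c (a + b - k) * of_real (clebsch_gordan \<mu> \<nu> k a b) * onb \<mu> a z * onb \<nu> b w)"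
proof -
  have "inner_H N (\<lambda>\<xi>. \<Sum>j\<le>N. c j * onb N j \<xi>) (Pk \<mu> \<nu> k (\<lambda>z' w'. onb \<mu> a z' * onb \<nu> b w')) =
      c (a + b - k) * of_real (clebsch_gordan \<mu> \<nu> k a b)" if "a \<le> \<mu>" "b \<le> \<nu>" for a b
  proof (cases "a + b - k \<le> N")
    case True
    then show ?thesis
      using Pk_onb[OF k that] inner_H_sum_onb[OF True] by (simp add: N_def)
  next
    case False
    then have "clebsch_gordan \<mu> \<nu> k a b = 0" using k by (intro clebsch_gordan_eq_0) (auto simp: N_def)
    then show ?thesis using Pk_onb[OF k that] by (simp add: inner_H_def)
  qed
  then show ?thesis
    unfolding Pk_adj_def N_def[symmetric] by (intro ext sum.cong refl) simp
qed

text \<open>Taking an arbitrary combination of basis vectors as argument gives a result of the same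
  shape, so the formula can be iterated.\<close>

lemma Tmap_sum_onb:
  fixes \<mu> \<nu> k :: nat and c :: "nat \<Rightarrow> complex"
  assumes k: "k \<le> \<mu>" "k \<le> \<nu>" and f: "cont_CP1 f"
  defines "N \<equiv> \<mu> + \<nu> - 2 * k"
  shows "Tmap \<mu> \<nu> k (Rstar \<mu> f) (\<lambda>\<xi>. \<Sum>j\<le>N. c j * onb N j \<xi>) =
    (\<lambda>\<xi>. \<Sum>i\<le>N. (\<Sum>j\<le>N. transfer_matrix \<mu> \<nu> k (Rstar_matrix \<mu> f) i j * c j) * onb N i \<xi>)"
proof
  fix \<xi>
  define g where "g = (\<lambda>a b. of_real (clebsch_gordan \<mu> \<nu> k a b) :: complex)"
  define R where "R = Rstar_matrix \<mu> f"
  have g0: "g a b = 0" if "\<not> (k \<le> a + b \<and> a + b \<le> \<mu> + \<nu> - k)" for a b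
    using clebsch_gordan_eq_0[OF k that] by (simp add: g_def)
  have "tensor_id (Rstar \<mu> f) (Pk_adj \<mu> \<nu> k (\<lambda>\<xi>. \<Sum>j\<le>N. c j * onb N j \<xi>)) =
      (\<lambda>z w. \<Sum>a\<le>\<mu>. \<Sum>b\<le>\<nu>. (\<Sum>a'\<le>\<mu>. R a a' * (c (a' + b - k) * g a' b)) * (onb \<mu> a z * onb \<nu> b w))"
  proof (intro ext)
    fix z w
    have "tensor_id (Rstar \<mu> f) (Pk_adj \<mu> \<nu> k (\<lambda>\<xi>. \<Sum>j\<le>N. c j * onb N j \<xi>)) z w =
      Rstar \<mu> f (\<lambda>z. \<Sum>a'\<le>\<mu>. (\<Sum>b\<le>\<nu>. c (a' + b - k) * g a' b * onb \<nu> b w) * onb \<mu> a' z) z"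
      unfolding tensor_id_def N_def Pk_adj_sum_onb[OF k] g_def
      by (simp add: sum_distrib_left sum_distrib_right mult_ac)
    also have "\<dots> = (\<Sum>a\<le>\<mu>. (\<Sum>a'\<le>\<mu>. R a a' * (\<Sum>b\<le>\<nu>. c (a' + b - k) * g a' b * onb \<nu> b w)) * onb \<mu> a z)"
      unfolding Rstar_sum_onb[OF f] R_def ..
    also have "\<dots> = (\<Sum>a\<le>\<mu>. \<Sum>b\<le>\<nu>. (\<Sum>a'\<le>\<mu>. R a a' * (c (a' + b - k) * g a' b)) * (onb \<mu> a z * onb \<nu> b w))"
      unfolding sum_distrib_left sum_distrib_right
      by (rule sum.cong[OF refl], subst sum.swap) (simp add: mult_ac)
    finally show "tensor_id (Rstar \<mu> f) (Pk_adj \<mu> \<nu> k (\<lambda>\<xi>. \<Sum>j\<le>N. c j * onb N j \<xi>)) z w =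
      (\<Sum>a\<le>\<mu>. \<Sum>b\<le>\<nu>. (\<Sum>a'\<le>\<mu>. R a a' * (c (a' + b - k) * g a' b)) * (onb \<mu> a z * onb \<nu> b w))" .
  qed
  then have "Tmap \<mu> \<nu> k (Rstar \<mu> f) (\<lambda>\<xi>. \<Sum>j\<le>N. c j * onb N j \<xi>) \<xi> =
      (\<Sum>a\<le>\<mu>. \<Sum>b\<le>\<nu>. (\<Sum>a'\<le>\<mu>. R a a' * (c (a' + b - k) * g a' b)) * g a b * onb N (a + b - k) \<xi>)"
    unfolding Tmap_def by (simp add: Pk_sum_onb[OF k] g_def N_def)
  also have "\<dots> = (\<Sum>a\<le>\<mu>. \<Sum>b\<le>\<nu>. \<Sum>a'\<le>\<mu>. R a a' * g a b * g a' b * (c (a' + b - k) * onb N (a + b - k) \<xi>))"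
    by (simp add: sum_distrib_left sum_distrib_right mult_ac)
  \<comment> \<open>Each term is spread over all pairs \<open>(i, j)\<close> by the indicator of its
    own position; exchanging the sums then collects the matrix entries. A term without a position in
    the range has a vanishing coefficient.\<close>
  also have "\<dots> = (\<Sum>a\<le>\<mu>. \<Sum>b\<le>\<nu>. \<Sum>a'\<le>\<mu>. \<Sum>i\<le>N. \<Sum>j\<le>N.
      if a + b = i + k \<and> a' + b = j + k then R a a' * g a b * g a' b * (c j * onb N i \<xi>) else 0)"
  proof (intro sum.cong refl)
    fix a b a'
    show "R a a' * g a b * g a' b * (c (a' + b - k) * onb N (a + b - k) \<xi>) = (\<Sum>i\<le>N. \<Sum>j\<le>N.
      if a + b = i + k \<and> a' + b = j + k then R a a' * g a b * g a' b * (c j * onb N i \<xi>) else 0)"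
    proof (cases "(k \<le> a + b \<and> a + b \<le> \<mu> + \<nu> - k) \<and> (k \<le> a' + b \<and> a' + b \<le> \<mu> + \<nu> - k)")
      case True
      have "(\<Sum>i\<le>N. \<Sum>j\<le>N. if a + b = i + k \<and> a' + b = j + k then R a a' * g a b * g a' b * (c j * onb N i \<xi>) else 0) =
          (\<Sum>i\<le>N. if i = a + b - k then (\<Sum>j\<le>N. if j = a' + b - k then R a a' * g a b * g a' b * (c j * onb N i \<xi>) else 0) else 0)"
      proof (rule sum.cong[OF refl])
        fix i
        have "a + b = i + k \<longleftrightarrow> i = a + b - k" "a' + b = j + k \<longleftrightarrow> j = a' + b - k" for j
          using True by auto
        then show "(\<Sum>j\<le>N. if a + b = i + k \<and> a' + b = j + k then R a a' * g a b * g a' b * (c j * onb N i \<xi>) else 0) =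
          (if i = a + b - k then (\<Sum>j\<le>N. if j = a' + b - k then R a a' * g a b * g a' b * (c j * onb N i \<xi>) else 0) else 0)"
          by (cases "i = a + b - k") simp_all
      qed
      also have "\<dots> = R a a' * g a b * g a' b * (c (a' + b - k) * onb N (a + b - k) \<xi>)"
      proof -
        have "a + b - k \<le> N" "a' + b - k \<le> N" using True k by (auto simp: N_def)
        then show ?thesis by simp
      qed
      finally show ?thesis by simp
    next
      case False
      then have "g a b * g a' b = 0" using g0 by auto
      then show ?thesis by (simp add: mult.assoc[symmetric] sum.neutral)
    qed
  qed
  also have "\<dots> = (\<Sum>i\<le>N. \<Sum>j\<le>N. \<Sum>a\<le>\<mu>. \<Sum>b\<le>\<nu>. \<Sum>a'\<le>\<mu>.
      if a + b = i + k \<and> a' + b = j + k then R a a' * g a b * g a' b * (c j * onb N i \<xi>) else 0)"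
    by (simp only: sum_swap_double[where I="{..N}" and J="{..N}"])
  also have "\<dots> = (\<Sum>i\<le>N. (\<Sum>j\<le>N. transfer_matrix \<mu> \<nu> k R i j * c j) * onb N i \<xi>)"
    unfolding transfer_matrix_def sum_distrib_left sum_distrib_right
    by (intro sum.cong refl) (auto simp: g_def)
  finally show "Tmap \<mu> \<nu> k (Rstar \<mu> f) (\<lambda>\<xi>. \<Sum>j\<le>N. c j * onb N j \<xi>) \<xi> =
    (\<Sum>i\<le>N. (\<Sum>j\<le>N. transfer_matrix \<mu> \<nu> k (Rstar_matrix \<mu> f) i j * c j) * onb N i \<xi>)"
    by (simp add: R_def)
qed

primrec transfer_matrix_pow :: "nat \<Rightarrow> nat \<Rightarrow> nat \<Rightarrow> (nat \<Rightarrow> nat \<Rightarrow> complex) \<Rightarrow> nat \<Rightarrow> nat \<Rightarrow> nat \<Rightarrow> complex" where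
  "transfer_matrix_pow \<mu> \<nu> k A 0 i j = (if i = j then 1 else 0)"
| "transfer_matrix_pow \<mu> \<nu> k A (Suc n) i j = (\<Sum>l\<le>\<mu> + \<nu> - 2 * k. transfer_matrix \<mu> \<nu> k A i l * transfer_matrix_pow \<mu> \<nu> k A n l j)"

lemma Tmap_funpow_onb:
  fixes \<mu> \<nu> k :: nat
  assumes k: "k \<le> \<mu>" "k \<le> \<nu>" and f: "cont_CP1 f"
  defines "N \<equiv> \<mu> + \<nu> - 2 * k"
  assumes j: "j \<le> N"
  shows "(Tmap \<mu> \<nu> k (Rstar \<mu> f) ^^ n) (onb N j) = (\<lambda>\<xi>. \<Sum>i\<le>N. transfer_matrix_pow \<mu> \<nu> k (Rstar_matrix \<mu> f) n i j * onb N i \<xi>)"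
proof (induction n)
  case 0
  have "(if i = j then 1 else 0) * onb N i \<xi> = (if i = j then onb N i \<xi> else 0)" for i \<xi>
    by simp
  then show ?case using j by (simp only: transfer_matrix_pow.simps sum.delta finite_atMost) simp
next
  case (Suc n)
  then show ?case by (simp add: Tmap_sum_onb[OF k f] N_def)
qed

lemma trace_H_Tmap_funpow:
  fixes \<mu> \<nu> k :: nat
  assumes k: "k \<le> \<mu>" "k \<le> \<nu>" and f: "cont_CP1 f"
  shows "trace_H (\<mu> + \<nu> - 2 * k) (Tmap \<mu> \<nu> k (Rstar \<mu> f) ^^ n) =
    (\<Sum>j\<le>\<mu> + \<nu> - 2 * k. transfer_matrix_pow \<mu> \<nu> k (Rstar_matrix \<mu> f) n j j)"
  unfolding trace_H_def
proof (intro sum.cong refl)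
  fix j assume "j \<in> {..\<mu> + \<nu> - 2 * k}"
  then have j: "j \<le> \<mu> + \<nu> - 2 * k" by simp
  show "inner_H (\<mu> + \<nu> - 2 * k) ((Tmap \<mu> \<nu> k (Rstar \<mu> f) ^^ n) (onb (\<mu> + \<nu> - 2 * k) j)) (onb (\<mu> + \<nu> - 2 * k) j) =
      transfer_matrix_pow \<mu> \<nu> k (Rstar_matrix \<mu> f) n j j"
    using inner_H_sum_onb[OF j, of "\<lambda>i. transfer_matrix_pow \<mu> \<nu> k (Rstar_matrix \<mu> f) n i j" 1]
    unfolding Tmap_funpow_onb[OF k f j] by simp
qed

section \<open>Asymptotics of the matrix entries\<close>

text \<open>Adding \<open>c\<close> fixed elements out of \<open>m\<close> new ones maps
  \<open>t\<close>-subsets injectively to \<open>(t + c)\<close>-subsets. The induction adds the new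
  elements one by one, each either left out or taken.\<close>

lemma binomial_le_binomial_add:
  assumes "c \<le> m"
  shows "(n choose t) \<le> (n + m choose (t + c))"
  using assms
proof (induction m arbitrary: c)
  case (Suc m)
  show ?case
  proof (cases c)
    case 0
    have "(n choose t) \<le> (n + m choose (t + 0))" by (rule Suc.IH) simp
    also have "\<dots> \<le> (Suc (n + m) choose t)" by (simp add: binomial_right_mono)
    finally show ?thesis using 0 by simp
  next
    case (Suc c')
    then have "(n choose t) \<le> (n + m choose (t + c'))" using Suc.IH Suc.prems by simp
    then show ?thesis using Suc by simp
  qed
qed simp

lemma tendsto_affine_ratio:
  fixes b L :: "nat \<Rightarrow> nat"
  assumes b: "(\<lambda>\<nu>. real (b \<nu>) / real \<nu>) \<longlonglongrightarrow> x" and L: "(\<lambda>\<nu>. real (L \<nu>) / real \<nu>) \<longlonglongrightarrow> 1"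
  shows "(\<lambda>\<nu>. (real (b \<nu>) + p) / (real (L \<nu>) + q)) \<longlonglongrightarrow> x"
proof -
  have c: "(\<lambda>\<nu>. p / real \<nu>) \<longlonglongrightarrow> 0" for p by real_asymp
  have "(\<lambda>\<nu>. (real (b \<nu>) / real \<nu> + p / real \<nu>) / (real (L \<nu>) / real \<nu> + q / real \<nu>)) \<longlonglongrightarrow> (x + 0) / (1 + 0)"
    by (intro tendsto_intros b L c) simp
  moreover have "\<forall>\<^sub>F \<nu> in sequentially. (real (b \<nu>) / real \<nu> + p / real \<nu>) / (real (L \<nu>) / real \<nu> + q / real \<nu>) =
      (real (b \<nu>) + p) / (real (L \<nu>) + q)"
    using eventually_gt_at_top[of 0]
    by eventually_elim (simp add: add_divide_distrib[symmetric])
  ultimately show ?thesis by (simp add: tendsto_cong)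
qed

text \<open>Provides room for shifts: a fixed margin \<open>m\<close> is small against
  \<open>(y - x) * \<nu>\<close>.\<close>

lemma eventually_scaled_le:
  fixes b L :: "nat \<Rightarrow> nat"
  assumes b: "(\<lambda>\<nu>. real (b \<nu>) / real \<nu>) \<longlonglongrightarrow> x" and L: "(\<lambda>\<nu>. real (L \<nu>) / real \<nu>) \<longlonglongrightarrow> y" and "x < y"
  shows "\<forall>\<^sub>F \<nu> in sequentially. b \<nu> + m \<le> L \<nu>"
proof -
  have c: "(\<lambda>\<nu>. real m / real \<nu>) \<longlonglongrightarrow> 0" by real_asymp
  have "(\<lambda>\<nu>. real (L \<nu>) / real \<nu> - real (b \<nu>) / real \<nu> - real m / real \<nu>) \<longlonglongrightarrow> y - x - 0"
    by (intro tendsto_intros b L c)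
  then have "\<forall>\<^sub>F \<nu> in sequentially. real (L \<nu>) / real \<nu> - real (b \<nu>) / real \<nu> - real m / real \<nu> > 0"
    using \<open>x < y\<close> by (intro order_tendstoD) auto
  then show ?thesis
    using eventually_gt_at_top[of 0]
  proof eventually_elim
    case (elim \<nu>)
    then have "real (b \<nu>) + real m < real (L \<nu>)"
      by (simp add: diff_divide_distrib[symmetric] zero_less_divide_iff)
    then show ?case by linarith
  qed
qed

text \<open>The quotient is the probability that a random subset of size \<open>b + c\<close> in a
  set of \<open>L + m\<close> elements meets \<open>m\<close> marked elements exactly in
  \<open>c\<close> prescribed ones. In the limit the marked elements are chosen independently, each
  with probability \<open>x\<close>. The induction adds one marked element at a time.\<close>

lemma binomial_ratio_tendsto:
  fixes b L :: "nat \<Rightarrow> nat"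
  assumes b: "(\<lambda>\<nu>. real (b \<nu>) / real \<nu>) \<longlonglongrightarrow> x" and L: "(\<lambda>\<nu>. real (L \<nu>) / real \<nu>) \<longlonglongrightarrow> 1"
    and x: "x < 1" and c: "c \<le> m"
  shows "(\<lambda>\<nu>. real (L \<nu> choose b \<nu>) / real (L \<nu> + m choose (b \<nu> + c))) \<longlonglongrightarrow> x ^ c * (1 - x) ^ (m - c)"
  using c
proof (induction m arbitrary: c)
  have ev: "\<forall>\<^sub>F \<nu> in sequentially. b \<nu> \<le> L \<nu>"
    using eventually_scaled_le[OF b L x, of 0] by simp
  {
    case 0
    have "\<forall>\<^sub>F \<nu> in sequentially. 1 = real (L \<nu> choose b \<nu>) / real (L \<nu> choose b \<nu>)"
      using ev by eventually_elim simp
    from Lim_transform_eventually[OF tendsto_const this] show ?case using 0 by simp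
  next
    case (Suc m)
    show ?case
    proof (cases c)
      case 0
      have IH: "(\<lambda>\<nu>. real (L \<nu> choose b \<nu>) / real (L \<nu> + m choose b \<nu>)) \<longlonglongrightarrow> (1 - x) ^ m"
        using Suc.IH[of 0] by simp
      \<comment> \<open>The factor is the probability that the additional element is not chosen by a
        subset of size \<open>b\<close> among \<open>L + m + 1\<close> elements.\<close>
      have "(\<lambda>\<nu>. 1 - (real (b \<nu>) + 0) / (real (L \<nu>) + (real m + 1))) \<longlonglongrightarrow> 1 - x"
        by (intro tendsto_intros tendsto_affine_ratio b L)
      from tendsto_mult[OF IH this]
      have "(\<lambda>\<nu>. real (L \<nu> choose b \<nu>) / real (L \<nu> + m choose b \<nu>) * (1 - (real (b \<nu>) + 0) / (real (L \<nu>) + (real m + 1)))) \<longlonglongrightarrow> (1 - x) ^ Suc m"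
        by (simp add: mult.commute)
      moreover have "\<forall>\<^sub>F \<nu> in sequentially. real (L \<nu> choose b \<nu>) / real (L \<nu> + m choose b \<nu>) * (1 - (real (b \<nu>) + 0) / (real (L \<nu>) + (real m + 1))) =
          real (L \<nu> choose b \<nu>) / real (L \<nu> + Suc m choose b \<nu>)"
        using ev
      proof eventually_elim
        case (elim \<nu>)
        define M where "M = L \<nu> + m"
        have le: "b \<nu> \<le> M" using elim by (simp add: M_def)
        have "(Suc M - b \<nu>) * (Suc M choose b \<nu>) = Suc M * (M choose b \<nu>)"
          using binomial_absorb_comp[of "Suc M" "b \<nu>"] by simp
        then have "(real (Suc M) - real (b \<nu>)) * real (Suc M choose b \<nu>) = real (Suc M) * real (M choose b \<nu>)"
          using le by (metis of_nat_diff of_nat_mult le_SucI)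
        moreover have "real (M choose b \<nu>) > 0" "real (Suc M choose b \<nu>) > 0" "real (Suc M) > 0" using le by auto
        ultimately have "(1 - real (b \<nu>) / real (Suc M)) / real (M choose b \<nu>) = 1 / real (Suc M choose b \<nu>)"
          by (simp add: divide_simps mult_ac del: of_nat_Suc)
        then have "real (L \<nu> choose b \<nu>) * ((1 - real (b \<nu>) / real (Suc M)) / real (M choose b \<nu>)) = real (L \<nu> choose b \<nu>) * (1 / real (Suc M choose b \<nu>))"
          by simp
        then show ?case by (simp add: M_def add_ac)
      qed
      ultimately show ?thesis using 0 by (simp add: tendsto_cong)
    next
      case (Suc c')
      then have IH: "(\<lambda>\<nu>. real (L \<nu> choose b \<nu>) / real (L \<nu> + m choose (b \<nu> + c'))) \<longlonglongrightarrow> x ^ c' * (1 - x) ^ (m - c')"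
        using Suc.IH[of c'] Suc.prems by simp
      \<comment> \<open>Here the additional element is chosen: a subset of size
        \<open>b + c' + 1\<close> among \<open>L + m + 1\<close> elements.\<close>
      have "(\<lambda>\<nu>. (real (b \<nu>) + (real c' + 1)) / (real (L \<nu>) + (real m + 1))) \<longlonglongrightarrow> x"
        by (intro tendsto_affine_ratio b L)
      from tendsto_mult[OF IH this]
      have "(\<lambda>\<nu>. real (L \<nu> choose b \<nu>) / real (L \<nu> + m choose (b \<nu> + c')) * ((real (b \<nu>) + (real c' + 1)) / (real (L \<nu>) + (real m + 1)))) \<longlonglongrightarrow> x ^ c * (1 - x) ^ (Suc m - c)"
        using Suc by (simp add: mult_ac)
      moreover have "\<forall>\<^sub>F \<nu> in sequentially. real (L \<nu> choose b \<nu>) / real (L \<nu> + m choose (b \<nu> + c')) * ((real (b \<nu>) + (real c' + 1)) / (real (L \<nu>) + (real m + 1))) =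
          real (L \<nu> choose b \<nu>) / real (L \<nu> + Suc m choose (b \<nu> + c))"
        using ev
      proof eventually_elim
        case (elim \<nu>)
        define M t where "M = L \<nu> + m" and "t = b \<nu> + c'"
        have le: "t \<le> M" using elim Suc Suc.prems by (simp add: M_def t_def)
        have "real (Suc t) * real (Suc M choose Suc t) = real (Suc M) * real (M choose t)"
          using Suc_times_binomial[of t M] by (metis of_nat_mult)
        moreover have "real (M choose t) > 0" "real (Suc M choose Suc t) > 0"
          using le by (simp_all del: binomial_Suc_Suc)
        ultimately have "(real (Suc t) / real (Suc M)) / real (M choose t) = 1 / real (Suc M choose Suc t)"
          by (simp add: field_simps del: binomial_Suc_Suc of_nat_Suc)
        then have "real (L \<nu> choose b \<nu>) * ((real (Suc t) / real (Suc M)) / real (M choose t)) = real (L \<nu> choose b \<nu>) * (1 / real (Suc M choose Suc t))"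
          by simp
        then show ?case using Suc by (simp add: M_def t_def ac_simps del: binomial_Suc_Suc)
      qed
      ultimately show ?thesis by (simp add: tendsto_cong)
    qed
  }
qed

text \<open>Factor by factor, the quotient of the two Pochhammer symbols containing \<nu> tends to
  \<open>(-1) ^ k\<close>, and this sign turns \<open>pochhammer (- real \<mu>) k / fact k\<close>
  into a binomial coefficient. The square of the limit is the prefactor of \<open>E\<close>.\<close>

lemma Cmnk_tendsto:
  assumes "k \<le> \<mu>"
  shows "(\<lambda>\<nu>. Cmnk \<mu> \<nu> k) \<longlonglongrightarrow> sqrt (real (\<mu> choose k))"
proof -
  have "(\<lambda>\<nu>. \<Prod>i<k. (- real \<nu> + real i) / (real \<mu> + real \<nu> - 2 * real k + 2 + real i)) \<longlonglongrightarrow> (\<Prod>i<k. -1)"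
  proof (intro tendsto_prod)
    fix i
    show "(\<lambda>\<nu>. (- real \<nu> + real i) / (real \<mu> + real \<nu> - 2 * real k + 2 + real i)) \<longlonglongrightarrow> -1"
      by real_asymp
  qed
  then have "(\<lambda>\<nu>. pochhammer (- real \<nu>) k / pochhammer (real \<mu> + real \<nu> - 2 * real k + 2) k) \<longlonglongrightarrow> (-1) ^ k"
    by (simp add: pochhammer_prod prod_dividef atLeast0LessThan)
  then have "(\<lambda>\<nu>. sqrt (pochhammer (- real \<nu>) k / pochhammer (real \<mu> + real \<nu> - 2 * real k + 2) k * (pochhammer (- real \<mu>) k / fact k)))
      \<longlonglongrightarrow> sqrt ((-1) ^ k * (pochhammer (- real \<mu>) k / fact k))"
    by (intro tendsto_intros)
  moreover have "(-1) ^ k * (pochhammer (- real \<mu>) k / fact k) = real (\<mu> choose k)"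
    using gbinomial_pochhammer[of "real \<mu>" k] by (simp add: binomial_gbinomial)
  ultimately show ?thesis
    by (simp add: Cmnk_def mult_ac)
qed

lemma Cmnk_bounded:
  assumes "k \<le> \<mu>"
  obtains K where "\<And>\<nu>. \<bar>Cmnk \<mu> \<nu> k\<bar> \<le> K"
proof -
  have "Bseq (\<lambda>\<nu>. Cmnk \<mu> \<nu> k)"
    using Cmnk_tendsto[OF assms] by (intro convergent_imp_Bseq) (auto simp: convergent_def)
  then show ?thesis using that by (auto simp: Bseq_def)
qed

text \<open>\<open>Cmnk\<close> and the two roots of the ratio are replaced by their limits. Up to a
  phase this is also a coordinate of a normalised polynomial attached to the point \<open>z\<close>
  with height \<open>x\<close>; see \<open>coherent_coeff_polar\<close>.\<close>

definition clebsch_gordan_limit :: "nat \<Rightarrow> nat \<Rightarrow> nat \<Rightarrow> real \<Rightarrow> real" where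
  "clebsch_gordan_limit \<mu> k a x = sqrt (real (\<mu> choose k)) / sqrt (real (\<mu> choose a)) *
     (\<Sum>i\<le>k. \<Sum>s\<le>\<mu> - k. if i + s = a then
        (-1) ^ (k - i) * real (k choose i) * real (\<mu> - k choose s) *
        (sqrt x ^ (k - i + s) * sqrt (1 - x) ^ (i + (\<mu> - k - s))) else 0)"

lemma clebsch_gordan_ratio_bounded:
  assumes "k \<le> \<mu>" "k \<le> \<nu>" "i \<le> k" "s \<le> \<mu> - k"
  shows "\<bar>clebsch_gordan_ratio \<mu> \<nu> k i s b\<bar> \<le> 1"
proof (cases "k - i \<le> b")
  case True
  define t where "t = b - (k - i)"
  have 1: "(\<nu> - k choose t) \<le> (\<nu> choose b)"
    using binomial_le_binomial_add[of "k - i" k "\<nu> - k" t] True assms by (simp add: t_def)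
  have 2: "(\<nu> - k choose t) \<le> (\<mu> + \<nu> - 2 * k choose (t + s))"
  proof -
    have "\<nu> - k + (\<mu> - k) = \<mu> + \<nu> - 2 * k" using assms by simp
    then show ?thesis using binomial_le_binomial_add[of s "\<mu> - k" "\<nu> - k" t] assms by simp
  qed
  have *: "sqrt (real p / real q) \<le> 1" if "p \<le> q" for p q :: nat
    using that by (cases "q = 0") (simp_all add: divide_le_eq_1)
  show ?thesis
    using True mult_mono[OF *[OF 1] *[OF 2]] by (simp add: clebsch_gordan_ratio_def t_def[symmetric] abs_mult)
qed (simp add: clebsch_gordan_ratio_def)

text \<open>Both roots have the numerator \<open>\<nu> - k choose t\<close>. The first adds
  \<open>k\<close> marked elements of which \<open>k - i\<close> are chosen, the second adds
  \<open>\<mu> - k\<close> of which \<open>s\<close> are chosen.\<close>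

lemma clebsch_gordan_ratio_tendsto:
  fixes b :: "nat \<Rightarrow> nat"
  assumes k: "k \<le> \<mu>" and i: "i \<le> k" and s: "s \<le> \<mu> - k"
    and b: "(\<lambda>\<nu>. real (b \<nu>) / real \<nu>) \<longlonglongrightarrow> x" and x: "0 < x" "x < 1"
  shows "(\<lambda>\<nu>. clebsch_gordan_ratio \<mu> \<nu> k i s (b \<nu>)) \<longlonglongrightarrow> sqrt x ^ (k - i + s) * sqrt (1 - x) ^ (i + (\<mu> - k - s))"
proof -
  define t where "t = (\<lambda>\<nu>. b \<nu> - (k - i))"
  define L where "L = (\<lambda>\<nu>::nat. \<nu> - k)"
  \<comment> \<open>This is where \<open>x > 0\<close> enters: \<open>b\<close> outgrows
    \<open>k\<close>, so the truncated \<open>b - (k - i)\<close> becomes a true difference.\<close>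
  have ev: "\<forall>\<^sub>F \<nu> in sequentially. k \<le> b \<nu>"
    using eventually_scaled_le[of "\<lambda>_. 0" 0 b x k] b x by simp
  have L: "(\<lambda>\<nu>. real (L \<nu>) / real \<nu>) \<longlonglongrightarrow> 1"
  proof -
    have "(\<lambda>\<nu>. (real \<nu> - real k) / real \<nu>) \<longlonglongrightarrow> 1" by real_asymp
    moreover have "\<forall>\<^sub>F \<nu> in sequentially. (real \<nu> - real k) / real \<nu> = real (L \<nu>) / real \<nu>"
      using eventually_ge_at_top[of k] by eventually_elim (simp add: L_def of_nat_diff)
    ultimately show ?thesis by (rule Lim_transform_eventually)
  qed
  have t: "(\<lambda>\<nu>. real (t \<nu>) / real \<nu>) \<longlonglongrightarrow> x"
  proof -
    have "(\<lambda>\<nu>. real (k - i) / real \<nu>) \<longlonglongrightarrow> 0" by real_asymp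
    from tendsto_diff[OF b this] have "(\<lambda>\<nu>. real (b \<nu>) / real \<nu> - real (k - i) / real \<nu>) \<longlonglongrightarrow> x" by simp
    moreover have "\<forall>\<^sub>F \<nu> in sequentially. real (b \<nu>) / real \<nu> - real (k - i) / real \<nu> = real (t \<nu>) / real \<nu>"
      using ev by eventually_elim (simp add: t_def of_nat_diff diff_divide_distrib)
    ultimately show ?thesis by (rule Lim_transform_eventually)
  qed
  have 1: "(\<lambda>\<nu>. sqrt (real (L \<nu> choose t \<nu>) / real (L \<nu> + k choose (t \<nu> + (k - i))))) \<longlonglongrightarrow> sqrt (x ^ (k - i) * (1 - x) ^ (k - (k - i)))"
    by (intro tendsto_real_sqrt binomial_ratio_tendsto[OF t L x(2)]) simp
  have 2: "(\<lambda>\<nu>. sqrt (real (L \<nu> choose t \<nu>) / real (L \<nu> + (\<mu> - k) choose (t \<nu> + s)))) \<longlonglongrightarrow> sqrt (x ^ s * (1 - x) ^ (\<mu> - k - s))"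
    by (intro tendsto_real_sqrt binomial_ratio_tendsto[OF t L x(2)] s)
  have lim: "sqrt (x ^ (k - i) * (1 - x) ^ (k - (k - i))) * sqrt (x ^ s * (1 - x) ^ (\<mu> - k - s)) =
      sqrt x ^ (k - i + s) * sqrt (1 - x) ^ (i + (\<mu> - k - s))"
    using i by (simp add: real_sqrt_mult real_sqrt_power power_add del: Nat.add_diff_assoc2 Nat.add_diff_assoc)
  have "\<forall>\<^sub>F \<nu> in sequentially. sqrt (real (L \<nu> choose t \<nu>) / real (L \<nu> + k choose (t \<nu> + (k - i)))) *
      sqrt (real (L \<nu> choose t \<nu>) / real (L \<nu> + (\<mu> - k) choose (t \<nu> + s))) = clebsch_gordan_ratio \<mu> \<nu> k i s (b \<nu>)"
    using ev eventually_ge_at_top[of k]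
  proof eventually_elim
    case (elim \<nu>)
    have "L \<nu> + k = \<nu>" "L \<nu> + (\<mu> - k) = \<mu> + \<nu> - 2 * k" "t \<nu> + (k - i) = b \<nu>" "k - i \<le> b \<nu>"
      using elim k by (auto simp: L_def t_def)
    then show ?case by (simp only: clebsch_gordan_ratio_def if_True) (simp add: L_def t_def)
  qed
  from Lim_transform_eventually[OF tendsto_mult[OF 1 2] this] show ?thesis by (simp only: lim)
qed

lemma clebsch_gordan_tendsto:
  fixes b :: "nat \<Rightarrow> nat"
  assumes k: "k \<le> \<mu>" and a: "a \<le> \<mu>"
    and b: "(\<lambda>\<nu>. real (b \<nu>) / real \<nu>) \<longlonglongrightarrow> x" and x: "0 < x" "x < 1"
  shows "(\<lambda>\<nu>. clebsch_gordan \<mu> \<nu> k a (b \<nu>)) \<longlonglongrightarrow> clebsch_gordan_limit \<mu> k a x"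
proof -
  have "(\<lambda>\<nu>. if i + s = a then (-1) ^ (k - i) * real (k choose i) * real (\<mu> - k choose s) * clebsch_gordan_ratio \<mu> \<nu> k i s (b \<nu>) else 0)
    \<longlonglongrightarrow> (if i + s = a then (-1) ^ (k - i) * real (k choose i) * real (\<mu> - k choose s) *
        (sqrt x ^ (k - i + s) * sqrt (1 - x) ^ (i + (\<mu> - k - s))) else 0)" if "i \<le> k" "s \<le> \<mu> - k" for i s
    using clebsch_gordan_ratio_tendsto[OF k that b x] by (cases "i + s = a") (auto intro!: tendsto_mult)
  then show ?thesis
    unfolding clebsch_gordan_def clebsch_gordan_limit_def using a
    by (intro tendsto_mult tendsto_divide tendsto_sum Cmnk_tendsto k tendsto_const) auto
qed

text \<open>The bound is uniform in \<nu> and \<open>b\<close>, hence also valid near the ends of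
  the range, about which the limit statements say nothing.\<close>

lemma clebsch_gordan_bounded:
  assumes k: "k \<le> \<mu>"
  obtains K where "K \<ge> 0" "\<And>\<nu> a b. k \<le> \<nu> \<Longrightarrow> a \<le> \<mu> \<Longrightarrow> \<bar>clebsch_gordan \<mu> \<nu> k a b\<bar> \<le> K"
proof -
  obtain C where C: "\<And>\<nu>. \<bar>Cmnk \<mu> \<nu> k\<bar> \<le> C" using Cmnk_bounded[OF k] by blast
  define S where "S = (\<Sum>i\<le>k. \<Sum>s\<le>\<mu> - k. real (k choose i) * real (\<mu> - k choose s))"
  have C0: "C \<ge> 0" using C[of 0] by linarith
  have S0: "S \<ge> 0" by (simp add: S_def sum_nonneg)
  have "\<bar>clebsch_gordan \<mu> \<nu> k a b\<bar> \<le> C * S" if "k \<le> \<nu>" "a \<le> \<mu>" for \<nu> a b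
  proof -
    have "\<bar>\<Sum>i\<le>k. \<Sum>s\<le>\<mu> - k. if i + s = a then
        (-1) ^ (k - i) * real (k choose i) * real (\<mu> - k choose s) * clebsch_gordan_ratio \<mu> \<nu> k i s b else 0\<bar> \<le> S"
      unfolding S_def
    proof (intro order_trans[OF sum_abs] sum_mono)
      fix i s assume "i \<in> {..k}" "s \<in> {..\<mu> - k}"
      then have "\<bar>clebsch_gordan_ratio \<mu> \<nu> k i s b\<bar> \<le> 1" using clebsch_gordan_ratio_bounded[OF k that(1)] by auto
      then show "\<bar>if i + s = a then
        (-1) ^ (k - i) * real (k choose i) * real (\<mu> - k choose s) * clebsch_gordan_ratio \<mu> \<nu> k i s b else 0\<bar> \<le> real (k choose i) * real (\<mu> - k choose s)"
        by (auto simp: abs_mult power_abs intro: mult_left_le)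
    qed
    moreover have "\<bar>Cmnk \<mu> \<nu> k / sqrt (real (\<mu> choose a))\<bar> \<le> C"
    proof -
      have "1 \<le> sqrt (real (\<mu> choose a))" using that by (simp add: Suc_leI zero_less_binomial)
      then have "\<bar>Cmnk \<mu> \<nu> k\<bar> / sqrt (real (\<mu> choose a)) \<le> \<bar>Cmnk \<mu> \<nu> k\<bar>"
        by (simp add: divide_le_eq mult_le_cancel_left1)
      then show ?thesis using C[of \<nu>] by (simp add: abs_divide)
    qed
    ultimately show ?thesis unfolding clebsch_gordan_def abs_mult using C0 by (intro mult_mono) auto
  qed
  then show ?thesis using that[of "C * S"] C0 S0 by simp
qed

section \<open>Limits along the diagonals and uniform bounds\<close>

text \<open>The Toeplitz symbol at height \<open>x\<close>: what becomes of the entries with column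
  minus row equal to \<open>d\<close>.\<close>

definition fourier_coeff :: "nat \<Rightarrow> nat \<Rightarrow> (nat \<Rightarrow> nat \<Rightarrow> complex) \<Rightarrow> int \<Rightarrow> real \<Rightarrow> complex" where
  "fourier_coeff \<mu> k A d x = (\<Sum>a\<le>\<mu>. \<Sum>a'\<le>\<mu>. if int a' - int a = d
     then A a a' * of_real (clebsch_gordan_limit \<mu> k a x * clebsch_gordan_limit \<mu> k a' x) else 0)"

text \<open>Convolution powers, that is, the coefficients of the \<open>n\<close>-th power of the
  Laurent polynomial with coefficients \<open>fourier_coeff\<close>. These vanish outside the range
  given to \<open>e\<close>.\<close>

primrec fourier_coeff_pow :: "nat \<Rightarrow> nat \<Rightarrow> (nat \<Rightarrow> nat \<Rightarrow> complex) \<Rightarrow> nat \<Rightarrow> int \<Rightarrow> real \<Rightarrow> complex" where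
  "fourier_coeff_pow \<mu> k A 0 d x = (if d = 0 then 1 else 0)"
| "fourier_coeff_pow \<mu> k A (Suc n) d x = (\<Sum>e\<in>{- int \<mu>..int \<mu>}. fourier_coeff \<mu> k A e x * fourier_coeff_pow \<mu> k A n (d - e) x)"

lemma transfer_matrix_eq_0:
  assumes "\<bar>int j - int i\<bar> > int \<mu>"
  shows "transfer_matrix \<mu> \<nu> k A i j = 0"
  unfolding transfer_matrix_def using assms by (intro sum.neutral ballI) auto

text \<open>Away from the ends every \<open>a\<close> admits exactly one \<open>b\<close>, namely
  \<open>i + k - a\<close>: the hypothesis \<open>\<mu> \<le> i\<close> excludes truncation and
  \<open>i + k \<le> \<nu>\<close> keeps \<open>b\<close> in range. The remaining constraint then
  compares index differences only.\<close>

lemma transfer_matrix_eq: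
  assumes "\<mu> \<le> i" "i + k \<le> \<nu>"
  shows "transfer_matrix \<mu> \<nu> k A i j = (\<Sum>a\<le>\<mu>. \<Sum>a'\<le>\<mu>. if int a' - int a = int j - int i
     then A a a' * of_real (clebsch_gordan \<mu> \<nu> k a (i + k - a) * clebsch_gordan \<mu> \<nu> k a' (i + k - a)) else 0)"
  unfolding transfer_matrix_def
proof (rule sum.cong[OF refl])
  fix a assume "a \<in> {..\<mu>}"
  then have a: "a \<le> i" "i + k - a \<le> \<nu>" using assms by auto
  have "(\<Sum>b\<le>\<nu>. \<Sum>a'\<le>\<mu>. if a + b = i + k \<and> a' + b = j + k then A a a' * of_real (clebsch_gordan \<mu> \<nu> k a b * clebsch_gordan \<mu> \<nu> k a' b) else 0) =
      (\<Sum>b\<le>\<nu>. if b = i + k - a then (\<Sum>a'\<le>\<mu>. if int a' - int a = int j - int i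
         then A a a' * of_real (clebsch_gordan \<mu> \<nu> k a b * clebsch_gordan \<mu> \<nu> k a' b) else 0) else 0)"
  proof (rule sum.cong[OF refl])
    fix b
    show "(\<Sum>a'\<le>\<mu>. if a + b = i + k \<and> a' + b = j + k then A a a' * of_real (clebsch_gordan \<mu> \<nu> k a b * clebsch_gordan \<mu> \<nu> k a' b) else 0) =
      (if b = i + k - a then (\<Sum>a'\<le>\<mu>. if int a' - int a = int j - int i
         then A a a' * of_real (clebsch_gordan \<mu> \<nu> k a b * clebsch_gordan \<mu> \<nu> k a' b) else 0) else 0)"
    proof (cases "b = i + k - a")
      case True
      then have "a + b = i + k" "\<And>a'. a' + b = j + k \<longleftrightarrow> int a' - int a = int j - int i" using a by auto
      then show ?thesis using True by simp
    next
      case False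
      then have "a + b \<noteq> i + k" by auto
      then show ?thesis using False by simp
    qed
  qed
  also have "\<dots> = (\<Sum>a'\<le>\<mu>. if int a' - int a = int j - int i
     then A a a' * of_real (clebsch_gordan \<mu> \<nu> k a (i + k - a) * clebsch_gordan \<mu> \<nu> k a' (i + k - a)) else 0)"
    using a by simp
  finally show "(\<Sum>b\<le>\<nu>. \<Sum>a'\<le>\<mu>. if a + b = i + k \<and> a' + b = j + k then A a a' * of_real (clebsch_gordan \<mu> \<nu> k a b * clebsch_gordan \<mu> \<nu> k a' b) else 0) = \<dots>" .
qed

lemma tendsto_ratio_shift:
  fixes i j :: "nat \<Rightarrow> nat"
  assumes i: "(\<lambda>\<nu>. real (i \<nu>) / real \<nu>) \<longlonglongrightarrow> x" and ij: "\<forall>\<^sub>F \<nu> in sequentially. int (j \<nu>) - int (i \<nu>) = d"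
  shows "(\<lambda>\<nu>. real (j \<nu>) / real \<nu>) \<longlonglongrightarrow> x"
proof -
  have "(\<lambda>\<nu>. real_of_int d / real \<nu>) \<longlonglongrightarrow> 0" by real_asymp
  from tendsto_add[OF i this] have "(\<lambda>\<nu>. real (i \<nu>) / real \<nu> + real_of_int d / real \<nu>) \<longlonglongrightarrow> x" by simp
  moreover have "\<forall>\<^sub>F \<nu> in sequentially. real (i \<nu>) / real \<nu> + real_of_int d / real \<nu> = real (j \<nu>) / real \<nu>"
    using ij
  proof eventually_elim
    case (elim \<nu>)
    then have "real (i \<nu>) + real_of_int d = real (j \<nu>)" by linarith
    then show ?case by (metis add_divide_distrib)
  qed
  ultimately show ?thesis by (rule Lim_transform_eventually)
qed

lemma eventually_interior:
  fixes i :: "nat \<Rightarrow> nat"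
  assumes i: "(\<lambda>\<nu>. real (i \<nu>) / real \<nu>) \<longlonglongrightarrow> x" and x: "0 < x" "x < 1"
  shows "\<forall>\<^sub>F \<nu> in sequentially. m \<le> i \<nu> \<and> i \<nu> + m \<le> \<nu>"
proof (rule eventually_conj)
  show "\<forall>\<^sub>F \<nu> in sequentially. m \<le> i \<nu>"
    using eventually_scaled_le[of "\<lambda>_. 0" 0 i x m] i x by simp
  have "(\<lambda>\<nu>. real \<nu> / real \<nu>) \<longlonglongrightarrow> 1" by real_asymp
  then show "\<forall>\<^sub>F \<nu> in sequentially. i \<nu> + m \<le> \<nu>"
    using eventually_scaled_le[of i x "\<lambda>\<nu>. \<nu>" 1 m] i x by simp
qed

lemma transfer_matrix_tendsto:
  fixes i j :: "nat \<Rightarrow> nat"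
  assumes k: "k \<le> \<mu>" and i: "(\<lambda>\<nu>. real (i \<nu>) / real \<nu>) \<longlonglongrightarrow> x" and x: "0 < x" "x < 1"
    and ij: "\<forall>\<^sub>F \<nu> in sequentially. int (j \<nu>) - int (i \<nu>) = d"
  shows "(\<lambda>\<nu>. transfer_matrix \<mu> \<nu> k A (i \<nu>) (j \<nu>)) \<longlonglongrightarrow> fourier_coeff \<mu> k A d x"
proof -
  have ev: "\<forall>\<^sub>F \<nu> in sequentially. \<mu> + k \<le> i \<nu> \<and> i \<nu> + (\<mu> + k) \<le> \<nu>"
    by (rule eventually_interior[OF i x])
  have b: "(\<lambda>\<nu>. real (i \<nu> + k - a) / real \<nu>) \<longlonglongrightarrow> x" if "a \<le> \<mu>" for a
  proof (rule tendsto_ratio_shift[OF i])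
    show "\<forall>\<^sub>F \<nu> in sequentially. int (i \<nu> + k - a) - int (i \<nu>) = int k - int a"
      using ev by eventually_elim (use that in auto)
  qed
  have "(\<lambda>\<nu>. \<Sum>a\<le>\<mu>. \<Sum>a'\<le>\<mu>. if int a' - int a = d
     then A a a' * of_real (clebsch_gordan \<mu> \<nu> k a (i \<nu> + k - a) * clebsch_gordan \<mu> \<nu> k a' (i \<nu> + k - a)) else 0) \<longlonglongrightarrow> fourier_coeff \<mu> k A d x"
    unfolding fourier_coeff_def
  proof (intro tendsto_sum)
    fix a a' assume a: "a \<in> {..\<mu>}" "a' \<in> {..\<mu>}"
    have "(\<lambda>\<nu>. A a a' * of_real (clebsch_gordan \<mu> \<nu> k a (i \<nu> + k - a) * clebsch_gordan \<mu> \<nu> k a' (i \<nu> + k - a))) \<longlonglongrightarrow>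
        A a a' * of_real (clebsch_gordan_limit \<mu> k a x * clebsch_gordan_limit \<mu> k a' x)"
      using a by (intro tendsto_intros clebsch_gordan_tendsto[OF k _ b x]) auto
    then show "(\<lambda>\<nu>. if int a' - int a = d
       then A a a' * of_real (clebsch_gordan \<mu> \<nu> k a (i \<nu> + k - a) * clebsch_gordan \<mu> \<nu> k a' (i \<nu> + k - a)) else 0) \<longlonglongrightarrow>
       (if int a' - int a = d then A a a' * of_real (clebsch_gordan_limit \<mu> k a x * clebsch_gordan_limit \<mu> k a' x) else 0)"
      by simp
  qed
  moreover have "\<forall>\<^sub>F \<nu> in sequentially. (\<Sum>a\<le>\<mu>. \<Sum>a'\<le>\<mu>. if int a' - int a = d
     then A a a' * of_real (clebsch_gordan \<mu> \<nu> k a (i \<nu> + k - a) * clebsch_gordan \<mu> \<nu> k a' (i \<nu> + k - a)) else 0) = transfer_matrix \<mu> \<nu> k A (i \<nu>) (j \<nu>)"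
    using ev ij by eventually_elim (subst transfer_matrix_eq, auto)
  ultimately show ?thesis by (rule Lim_transform_eventually)
qed

text \<open>The hypotheses say that the whole band around row \<open>i\<close> lies in the index
  range, so no term is cut off and \<open>l\<close> may be replaced by the offset \<open>e\<close>
  from \<open>i\<close>.\<close>

lemma transfer_matrix_pow_Suc_band:
  assumes "\<mu> \<le> i" "i + \<mu> \<le> \<mu> + \<nu> - 2 * k"
  shows "transfer_matrix_pow \<mu> \<nu> k A (Suc n) i j =
    (\<Sum>e\<in>{- int \<mu>..int \<mu>}. transfer_matrix \<mu> \<nu> k A i (nat (int i + e)) * transfer_matrix_pow \<mu> \<nu> k A n (nat (int i + e)) j)"
proof -
  have "transfer_matrix_pow \<mu> \<nu> k A (Suc n) i j = (\<Sum>l\<in>{i - \<mu>..i + \<mu>}. transfer_matrix \<mu> \<nu> k A i l * transfer_matrix_pow \<mu> \<nu> k A n l j)"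
    unfolding transfer_matrix_pow.simps
  proof (rule sum.mono_neutral_right)
    show "\<forall>l\<in>{..\<mu> + \<nu> - 2 * k} - {i - \<mu>..i + \<mu>}. transfer_matrix \<mu> \<nu> k A i l * transfer_matrix_pow \<mu> \<nu> k A n l j = 0"
      by (intro ballI) (subst transfer_matrix_eq_0, auto)
  qed (use assms in auto)
  also have "\<dots> = (\<Sum>e\<in>{- int \<mu>..int \<mu>}. transfer_matrix \<mu> \<nu> k A i (nat (int i + e)) * transfer_matrix_pow \<mu> \<nu> k A n (nat (int i + e)) j)"
    by (rule sum.reindex_bij_witness[where i="\<lambda>e. nat (int i + e)" and j="\<lambda>l. int l - int i"])
       (use assms in auto)
  finally show ?thesis .
qed

text \<open>The column \<open>j\<close> stays while one factor of the power moves the row from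
  \<open>i\<close> to \<open>i + e\<close>; hence the induction generalises over \<open>i\<close>
  and \<open>d\<close>. A bounded move does not change the limit \<open>x\<close> of
  \<open>i / \<nu>\<close>.\<close>

lemma transfer_matrix_pow_tendsto:
  fixes i j :: "nat \<Rightarrow> nat"
  assumes k: "k \<le> \<mu>" and i: "(\<lambda>\<nu>. real (i \<nu>) / real \<nu>) \<longlonglongrightarrow> x" and x: "0 < x" "x < 1"
    and ij: "\<forall>\<^sub>F \<nu> in sequentially. int (j \<nu>) - int (i \<nu>) = d"
  shows "(\<lambda>\<nu>. transfer_matrix_pow \<mu> \<nu> k A n (i \<nu>) (j \<nu>)) \<longlonglongrightarrow> fourier_coeff_pow \<mu> k A n d x"
  using i ij
proof (induction n arbitrary: i d)
  case 0
  have "\<forall>\<^sub>F \<nu> in sequentially. fourier_coeff_pow \<mu> k A 0 d x = transfer_matrix_pow \<mu> \<nu> k A 0 (i \<nu>) (j \<nu>)"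
    using 0(2) by eventually_elim auto
  then show ?case by (rule Lim_transform_eventually[OF tendsto_const])
next
  case (Suc n)
  note i = Suc.prems(1) and ij = Suc.prems(2)
  \<comment> \<open>The lower margin keeps \<open>i + e\<close> nonnegative, the upper one gives
    \<open>i + \<mu> \<le> \<mu> + \<nu> - 2 * k\<close>, as the full band requires.\<close>
  have ev: "\<forall>\<^sub>F \<nu> in sequentially. \<mu> + 2 * k \<le> i \<nu> \<and> i \<nu> + (\<mu> + 2 * k) \<le> \<nu>"
    by (rule eventually_interior[OF i x])
  have "(\<lambda>\<nu>. \<Sum>e\<in>{- int \<mu>..int \<mu>}. transfer_matrix \<mu> \<nu> k A (i \<nu>) (nat (int (i \<nu>) + e)) * transfer_matrix_pow \<mu> \<nu> k A n (nat (int (i \<nu>) + e)) (j \<nu>))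
      \<longlonglongrightarrow> fourier_coeff_pow \<mu> k A (Suc n) d x"
    unfolding fourier_coeff_pow.simps
  proof (intro tendsto_sum tendsto_mult)
    fix e assume e: "e \<in> {- int \<mu>..int \<mu>}"
    have 1: "\<forall>\<^sub>F \<nu> in sequentially. int (nat (int (i \<nu>) + e)) - int (i \<nu>) = e"
      using ev by eventually_elim (use e in auto)
    have 2: "\<forall>\<^sub>F \<nu> in sequentially. int (j \<nu>) - int (nat (int (i \<nu>) + e)) = d - e"
      using ev ij by eventually_elim (use e in auto)
    show "(\<lambda>\<nu>. transfer_matrix \<mu> \<nu> k A (i \<nu>) (nat (int (i \<nu>) + e))) \<longlonglongrightarrow> fourier_coeff \<mu> k A e x"
      by (rule transfer_matrix_tendsto[OF k i x 1])
    show "(\<lambda>\<nu>. transfer_matrix_pow \<mu> \<nu> k A n (nat (int (i \<nu>) + e)) (j \<nu>)) \<longlonglongrightarrow> fourier_coeff_pow \<mu> k A n (d - e) x"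
      by (rule Suc.IH[OF tendsto_ratio_shift[OF i 1] 2])
  qed
  moreover have "\<forall>\<^sub>F \<nu> in sequentially. (\<Sum>e\<in>{- int \<mu>..int \<mu>}. transfer_matrix \<mu> \<nu> k A (i \<nu>) (nat (int (i \<nu>) + e)) * transfer_matrix_pow \<mu> \<nu> k A n (nat (int (i \<nu>) + e)) (j \<nu>)) =
      transfer_matrix_pow \<mu> \<nu> k A (Suc n) (i \<nu>) (j \<nu>)"
    using ev by eventually_elim (subst transfer_matrix_pow_Suc_band, auto)
  ultimately show ?case by (rule Lim_transform_eventually)
qed

text \<open>A row \<open>i\<close> and an \<open>a\<close> leave at most one \<open>b\<close>, so
  the number of nonzero terms does not grow with \<nu>.\<close>

lemma transfer_matrix_bounded:
  assumes k: "k \<le> \<mu>"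
  obtains K where "K \<ge> 0" "\<And>\<nu> i j. k \<le> \<nu> \<Longrightarrow> cmod (transfer_matrix \<mu> \<nu> k A i j) \<le> K"
proof -
  obtain G where G0: "G \<ge> 0" and G: "\<And>\<nu> a b. k \<le> \<nu> \<Longrightarrow> a \<le> \<mu> \<Longrightarrow> \<bar>clebsch_gordan \<mu> \<nu> k a b\<bar> \<le> G"
    using clebsch_gordan_bounded[OF k] by blast
  define K where "K = (\<Sum>a\<le>\<mu>. \<Sum>a'\<le>\<mu>. cmod (A a a') * (G * G))"
  have "cmod (transfer_matrix \<mu> \<nu> k A i j) \<le> K" if \<nu>: "k \<le> \<nu>" for \<nu> i j
  proof -
    have "cmod (transfer_matrix \<mu> \<nu> k A i j) \<le> (\<Sum>a\<le>\<mu>. \<Sum>b\<le>\<nu>. \<Sum>a'\<le>\<mu>. if b = i + k - a then cmod (A a a') * (G * G) else 0)"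
      unfolding transfer_matrix_def
    proof (intro order_trans[OF norm_sum] sum_mono)
      fix a b a' assume a: "a \<in> {..\<mu>}" "a' \<in> {..\<mu>}"
      have "cmod (A a a' * of_real (clebsch_gordan \<mu> \<nu> k a b * clebsch_gordan \<mu> \<nu> k a' b)) \<le> cmod (A a a') * (G * G)"
        unfolding norm_mult norm_of_real abs_mult using a G[OF \<nu>] G0
        by (intro mult_left_mono mult_mono) auto
      then show "cmod (if a + b = i + k \<and> a' + b = j + k then A a a' * of_real (clebsch_gordan \<mu> \<nu> k a b * clebsch_gordan \<mu> \<nu> k a' b) else 0)
        \<le> (if b = i + k - a then cmod (A a a') * (G * G) else 0)"
        using G0 by auto
    qed
    also have "\<dots> = (\<Sum>a\<le>\<mu>. \<Sum>a'\<le>\<mu>. \<Sum>b\<le>\<nu>. if b = i + k - a then cmod (A a a') * (G * G) else 0)"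
      by (intro sum.cong refl sum.swap)
    also have "\<dots> \<le> K"
      unfolding K_def using G0 by (intro sum_mono) simp
    finally show ?thesis .
  qed
  moreover have "K \<ge> 0" unfolding K_def using G0 by (intro sum_nonneg) simp
  ultimately show thesis using that by blast
qed

text \<open>A row has at most \<open>2 * \<mu> + 1\<close> nonzero entries, whatever \<nu> is, so
  each multiplication enlarges the bound by a fixed factor. The bound is the dominating constant for
  the passage to the limit.\<close>

lemma transfer_matrix_pow_bounded:
  assumes k: "k \<le> \<mu>"
  shows "\<exists>K. \<forall>\<nu> i j. k \<le> \<nu> \<longrightarrow> cmod (transfer_matrix_pow \<mu> \<nu> k A n i j) \<le> K"
proof (induction n)
  case 0
  show ?case by (rule exI[of _ 1]) simp
next
  case (Suc n)
  then obtain K where K: "\<And>\<nu> i j. k \<le> \<nu> \<Longrightarrow> cmod (transfer_matrix_pow \<mu> \<nu> k A n i j) \<le> K" by blast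
  obtain K' where K'0: "K' \<ge> 0" and K': "\<And>\<nu> i j. k \<le> \<nu> \<Longrightarrow> cmod (transfer_matrix \<mu> \<nu> k A i j) \<le> K'"
    using transfer_matrix_bounded[OF k] by blast
  have K0: "K \<ge> 0" using K[of k 0 0] norm_ge_zero order_trans by blast
  have "cmod (transfer_matrix_pow \<mu> \<nu> k A (Suc n) i j) \<le> real (2 * \<mu> + 1) * (K' * K)" if \<nu>: "k \<le> \<nu>" for \<nu> i j
  proof -
    define I where "I = {i - \<mu>..i + \<mu>}"
    have "cmod (transfer_matrix_pow \<mu> \<nu> k A (Suc n) i j) \<le> (\<Sum>l\<le>\<mu> + \<nu> - 2 * k. if l \<in> I then K' * K else 0)"
      unfolding transfer_matrix_pow.simps
    proof (intro order_trans[OF norm_sum] sum_mono)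
      fix l
      show "cmod (transfer_matrix \<mu> \<nu> k A i l * transfer_matrix_pow \<mu> \<nu> k A n l j) \<le> (if l \<in> I then K' * K else 0)"
      proof (cases "l \<in> I")
        case True
        then show ?thesis using K[OF \<nu>] K'[OF \<nu>] K'0 by (auto simp: norm_mult intro!: mult_mono)
      next
        case False
        then have "transfer_matrix \<mu> \<nu> k A i l = 0" by (intro transfer_matrix_eq_0) (auto simp: I_def)
        then show ?thesis using False by simp
      qed
    qed
    also have "\<dots> = (\<Sum>l\<in>{..\<mu> + \<nu> - 2 * k} \<inter> I. K' * K)"
      by (rule sum.inter_restrict[symmetric]) simp
    also have "\<dots> \<le> (\<Sum>l\<in>I. K' * K)"
      using K0 K'0 by (intro sum_mono2) (auto simp: I_def)
    also have "\<dots> \<le> real (2 * \<mu> + 1) * (K' * K)"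
    proof -
      have "card I \<le> 2 * \<mu> + 1" by (simp add: I_def)
      then have "real (card I) \<le> real (2 * \<mu> + 1)" by (simp only: of_nat_le_iff)
      then show ?thesis using K0 K'0 by (simp only: sum_constant mult_right_mono mult_nonneg_nonneg)
    qed
    finally show ?thesis .
  qed
  then show ?case by blast
qed

section \<open>From diagonal entries to the normalised trace\<close>

text \<open>A normalised sum is the exact integral of a step function with steps of width
  \<open>1 / \<nu>\<close>, which makes the sums accessible to dominated convergence.\<close>

lemma step_function_has_integral:
  fixes h :: "nat \<Rightarrow> complex"
  assumes \<nu>: "\<nu> > 0"
  shows "((\<lambda>x. h (nat \<lfloor>real \<nu> * x\<rfloor>)) has_integral (\<Sum>j<m. h j) / of_nat \<nu>) {0..real m / real \<nu>}"
proof (induction m)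
  case 0
  show ?case using has_integral_refl(2)[of _ "0::real"] by simp
next
  case (Suc m)
  define l u where "l = real m / real \<nu>" and "u = real (Suc m) / real \<nu>"
  have lu: "0 \<le> l" "l \<le> u" "u - l = 1 / real \<nu>"
    using \<nu> by (auto simp: l_def u_def field_simps)
  have "((\<lambda>x. h m) has_integral (u - l) *\<^sub>R h m) {l..u}"
    using has_integral_const_real[of "h m" l u] lu by simp
  \<comment> \<open>At the right endpoint \<open>u\<close> the floor already jumps to
    \<open>m + 1\<close>, so this point is left out.\<close>
  moreover have "h (nat \<lfloor>real \<nu> * x\<rfloor>) = h m" if "x \<in> {l..u} - {u}" for x
  proof -
    have "real m \<le> real \<nu> * x" "real \<nu> * x < real m + 1"
      using that \<nu> by (auto simp: l_def u_def field_simps)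
    then have "\<lfloor>real \<nu> * x\<rfloor> = int m" by (simp add: floor_unique)
    then show ?thesis by simp
  qed
  ultimately have "((\<lambda>x. h (nat \<lfloor>real \<nu> * x\<rfloor>)) has_integral (u - l) *\<^sub>R h m) {l..u}"
    by (metis (no_types, lifting) has_integral_spike_finite finite.emptyI finite.insertI)
  from has_integral_combine[OF lu(1,2) Suc.IH[folded l_def] this]
  show ?case unfolding u_def[symmetric] using \<nu> by (simp add: lu scaleR_conv_of_real add_divide_distrib)
qed

lemma mean_tendsto_integral:
  fixes h :: "nat \<Rightarrow> nat \<Rightarrow> complex" and \<phi> :: "real \<Rightarrow> complex"
  assumes bound: "\<And>\<nu> j. cmod (h \<nu> j) \<le> K"
    and lim: "\<And>x. 0 < x \<Longrightarrow> x < 1 \<Longrightarrow> (\<lambda>\<nu>. h \<nu> (nat \<lfloor>real \<nu> * x\<rfloor>)) \<longlonglongrightarrow> \<phi> x"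
  shows "(\<lambda>\<nu>. (\<Sum>j<\<nu>. h \<nu> j) / of_nat \<nu>) \<longlonglongrightarrow> integral {0..1} \<phi>"
proof -
  \<comment> \<open>The interval is open because the pointwise limit is known only strictly between
    0 and 1.\<close>
  have int: "((\<lambda>x. h \<nu> (nat \<lfloor>real \<nu> * x\<rfloor>)) has_integral (\<Sum>j<\<nu>. h \<nu> j) / of_nat \<nu>) {0<..<1}" if "\<nu> > 0" for \<nu>
    using step_function_has_integral[OF that, of "h \<nu>" \<nu>] that by (simp add: has_integral_Icc_iff_Ioo)
  \<comment> \<open>Integrability is required for every index of the sequence, and
    \<open>int\<close> does not cover \<nu> = 0; there the integrand is constant.\<close>
  have 0: "((\<lambda>x. h 0 (nat \<lfloor>real 0 * x\<rfloor>)) integrable_on {0<..<1})"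
    by (simp add: integrable_on_Icc_iff_Ioo[symmetric] integrable_const_ivl)
  have "(\<lambda>\<nu>. integral {0<..<1} (\<lambda>x. h \<nu> (nat \<lfloor>real \<nu> * x\<rfloor>))) \<longlonglongrightarrow> integral {0<..<1} \<phi>"
  proof (rule dominated_convergence(2))
    show "(\<lambda>x. h \<nu> (nat \<lfloor>real \<nu> * x\<rfloor>)) integrable_on {0<..<1}" for \<nu>
      using int[of \<nu>] 0 by (cases "\<nu> > 0") (auto simp: integrable_on_def)
    show "(\<lambda>x. K) integrable_on {0<..<1::real}"
      by (simp add: integrable_on_Icc_iff_Ioo[symmetric] integrable_const_ivl)
  qed (use bound lim in auto)
  moreover have "\<forall>\<^sub>F \<nu> in sequentially. integral {0<..<1} (\<lambda>x. h \<nu> (nat \<lfloor>real \<nu> * x\<rfloor>)) = (\<Sum>j<\<nu>. h \<nu> j) / of_nat \<nu>"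
    using eventually_gt_at_top[of 0] by eventually_elim (simp add: integral_unique[OF int])
  ultimately have "(\<lambda>\<nu>. (\<Sum>j<\<nu>. h \<nu> j) / of_nat \<nu>) \<longlonglongrightarrow> integral {0<..<1} \<phi>"
    by (rule Lim_transform_eventually)
  then show ?thesis by (simp add: integral_open_interval_real)
qed

text \<open>The trace has about \<nu> terms, but not exactly: at most \<open>2 * c + 1\<close>
  bounded terms are added or lost, and the division by \<nu> removes them in the limit.\<close>

lemma mean_tendsto_integral_shifted:
  fixes h :: "nat \<Rightarrow> nat \<Rightarrow> complex" and \<phi> :: "real \<Rightarrow> complex"
  assumes bound: "\<And>\<nu> j. cmod (h \<nu> j) \<le> K"
    and lim: "\<And>x. 0 < x \<Longrightarrow> x < 1 \<Longrightarrow> (\<lambda>\<nu>. h \<nu> (nat \<lfloor>real \<nu> * x\<rfloor>)) \<longlonglongrightarrow> \<phi> x"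
    and N: "\<And>\<nu>. \<nu> \<le> N \<nu> + c" "\<And>\<nu>. N \<nu> \<le> \<nu> + c"
  shows "(\<lambda>\<nu>. (\<Sum>j\<le>N \<nu>. h \<nu> j) / of_nat \<nu>) \<longlonglongrightarrow> integral {0..1} \<phi>"
proof -
  have K: "K \<ge> 0" using bound[of 0 0] norm_ge_zero order_trans by blast
  have diff: "cmod ((\<Sum>j\<le>N \<nu>. h \<nu> j) - (\<Sum>j<\<nu>. h \<nu> j)) \<le> real (2 * c + 1) * K" for \<nu>
  proof -
    have "(\<Sum>j\<le>N \<nu>. h \<nu> j) - (\<Sum>j<\<nu>. h \<nu> j) = (\<Sum>j\<in>{..N \<nu>} - {..<\<nu>}. h \<nu> j) - (\<Sum>j\<in>{..<\<nu>} - {..N \<nu>}. h \<nu> j)"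
      using sum.Int_Diff[of "{..N \<nu>}" "h \<nu>" "{..<\<nu>}"] sum.Int_Diff[of "{..<\<nu>}" "h \<nu>" "{..N \<nu>}"]
      by (simp add: Int_commute)
    also have "cmod \<dots> \<le> cmod (\<Sum>j\<in>{..N \<nu>} - {..<\<nu>}. h \<nu> j) + cmod (\<Sum>j\<in>{..<\<nu>} - {..N \<nu>}. h \<nu> j)"
      by (rule norm_triangle_ineq4)
    also have "\<dots> \<le> real (card ({..N \<nu>} - {..<\<nu>})) * K + real (card ({..<\<nu>} - {..N \<nu>})) * K"
      by (intro add_mono sum_norm_bound bound)
    also have "\<dots> \<le> real (c + 1) * K + real c * K"
    proof -
      have "card ({..N \<nu>} - {..<\<nu>}) \<le> card {\<nu>..\<nu> + c}" using N[of \<nu>] by (intro card_mono) auto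
      moreover have "card ({..<\<nu>} - {..N \<nu>}) \<le> card {N \<nu><..N \<nu> + c}" using N[of \<nu>] by (intro card_mono) auto
      ultimately have "card ({..N \<nu>} - {..<\<nu>}) \<le> c + 1" "card ({..<\<nu>} - {..N \<nu>}) \<le> c" by auto
      then show ?thesis using K by (intro add_mono mult_right_mono) (simp_all only: of_nat_le_iff)
    qed
    finally show ?thesis by (simp add: algebra_simps)
  qed
  have "(\<lambda>\<nu>. ((\<Sum>j\<le>N \<nu>. h \<nu> j) - (\<Sum>j<\<nu>. h \<nu> j)) / of_nat \<nu>) \<longlonglongrightarrow> 0"
  proof (rule Lim_null_comparison)
    show "\<forall>\<^sub>F \<nu> in sequentially. cmod (((\<Sum>j\<le>N \<nu>. h \<nu> j) - (\<Sum>j<\<nu>. h \<nu> j)) / of_nat \<nu>) \<le> real (2 * c + 1) * K / real \<nu>"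
      using diff by (intro always_eventually allI) (simp add: norm_divide divide_right_mono)
    show "(\<lambda>\<nu>. real (2 * c + 1) * K / real \<nu>) \<longlonglongrightarrow> 0" by real_asymp
  qed
  from tendsto_add[OF this mean_tendsto_integral[where h=h and \<phi>=\<phi>, OF bound lim]]
  show ?thesis by (simp add: diff_divide_distrib)
qed

section \<open>The limit symbol\<close>

text \<open>Lagrange's identity for the vectors \<open>(1, z)\<close> and \<open>(1, s)\<close>:
  squared inner product plus squared determinant equals the product of the squared norms.\<close>

lemma sphere_kernel_identity:
  "(cmod (1 + z * cnj s))^2 + (cmod (z - s))^2 = (1 + (cmod z)^2) * (1 + (cmod s)^2)"
  unfolding cmod_power2 by (simp add: power2_eq_square algebra_simps)

text \<open>The Berezin kernel of level \<open>m\<close> is the \<open>m\<close>-th power of the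
  overlap \<open>q\<close>, so the alternating sum in \<open>E\<close> acts on powers of
  \<open>q\<close> under one integral; the sphere identity then evaluates
  \<open>1 - q\<close>.\<close>

lemma E_eq_integral:
  assumes k: "k \<le> \<mu>" and f: "cont_CP1 f"
  shows "E \<mu> k f z = of_nat (\<mu> choose k) * (LINT s|iota 0.
     f s * of_real ((cmod (1 + z * cnj s) ^ 2) ^ (\<mu> - k) * (cmod (z - s) ^ 2) ^ k /
       ((1 + (cmod z)^2) ^ \<mu> * (1 + (cmod s)^2) ^ \<mu>)))"
proof -
  define q where "q = (\<lambda>s. (cmod (1 + z * cnj s))^2 / ((1 + (cmod z)^2) * (1 + (cmod s)^2)))"
  have pos: "(1 + (cmod z)^2) * (1 + (cmod s)^2) > 0" for s by (intro mult_pos_pos) simp_all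
  have q01: "0 \<le> q s" "q s \<le> 1" for s
    using sphere_kernel_identity[of z s] pos[of s] by (simp_all add: q_def divide_le_eq) (smt (verit) zero_le_power2)
  have q1: "1 - q s = (cmod (z - s))^2 / ((1 + (cmod z)^2) * (1 + (cmod s)^2))" for s
  proof -
    have "1 - q s = ((1 + (cmod z)^2) * (1 + (cmod s)^2) - (cmod (1 + z * cnj s))^2) / ((1 + (cmod z)^2) * (1 + (cmod s)^2))"
      using pos[of s] by (simp add: q_def diff_divide_distrib)
    then show ?thesis using sphere_kernel_identity[of z s] by simp
  qed
  have [measurable]: "q \<in> borel_measurable borel" unfolding q_def by measurable
  have int: "integrable (iota 0) (\<lambda>s. f s * of_real (q s ^ m))" for m
    using q01 by (intro integrable_cont_CP1_mult[OF f] integrable_iota_bound[where K=1])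
      (auto simp: norm_power power_le_one)
  have B: "Berezin m f z = (LINT s|iota 0. f s * of_real (q s ^ m))" for m
  proof -
    have "cmod (1 + z * cnj s) ^ (2 * m) / ((1 + (cmod z)^2) ^ m * (1 + (cmod s)^2) ^ m) = q s ^ m" for s
      by (simp only: q_def power_mult power_divide power_mult_distrib)
    then show ?thesis unfolding Berezin_def by (simp only: mult.commute[of _ "f _"])
  qed
  \<comment> \<open>This is the binomial expansion of \<open>(1 - x) ^ k\<close> multiplied by
    \<open>x ^ (\<mu> - k)\<close>, valid for every real \<open>x\<close>.\<close>
  have alt: "(\<Sum>l\<le>k. (-1) ^ (k - l) * real (k choose l) * x ^ (\<mu> - l)) = x ^ (\<mu> - k) * (1 - x) ^ k" for x :: real
  proof -
    have "(1 - x) ^ k = (\<Sum>l\<le>k. real (k choose l) * (- x) ^ (k - l))"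
      using binomial_ring[of 1 "- x" k] by simp
    then have "x ^ (\<mu> - k) * (1 - x) ^ k = (\<Sum>l\<le>k. x ^ (\<mu> - k) * (real (k choose l) * (- x) ^ (k - l)))"
      by (simp add: sum_distrib_left)
    also have "\<dots> = (\<Sum>l\<le>k. (-1) ^ (k - l) * real (k choose l) * x ^ (\<mu> - l))"
    proof (intro sum.cong refl)
      fix l assume "l \<in> {..k}"
      then have "x ^ (\<mu> - l) = x ^ (\<mu> - k) * x ^ (k - l)" using k by (simp add: power_add[symmetric])
      then show "x ^ (\<mu> - k) * (real (k choose l) * (- x) ^ (k - l)) = (-1) ^ (k - l) * real (k choose l) * x ^ (\<mu> - l)"
        by (simp add: power_minus[of x])
    qed
    finally show ?thesis by simp
  qed
  have "E \<mu> k f z = of_nat (\<mu> choose k) * (LINT s|iota 0. (\<Sum>l\<le>k. (-1) ^ (k - l) * of_nat (k choose l) * (f s * of_real (q s ^ (\<mu> - l)))))"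
    unfolding E_def B by (subst Bochner_Integration.integral_sum) (simp_all only: integral_mult_right_zero integrable_mult_right int)
  also have "(\<lambda>s. \<Sum>l\<le>k. (-1) ^ (k - l) * of_nat (k choose l) * (f s * of_real (q s ^ (\<mu> - l)))) =
      (\<lambda>s. f s * of_real ((cmod (1 + z * cnj s) ^ 2) ^ (\<mu> - k) * (cmod (z - s) ^ 2) ^ k /
       ((1 + (cmod z)^2) ^ \<mu> * (1 + (cmod s)^2) ^ \<mu>)))"
  proof
    fix s
    have "(\<Sum>l\<le>k. (-1) ^ (k - l) * of_nat (k choose l) * (f s * of_real (q s ^ (\<mu> - l)))) =
        f s * of_real (\<Sum>l\<le>k. (-1) ^ (k - l) * real (k choose l) * q s ^ (\<mu> - l))"
      by (simp add: sum_distrib_left mult_ac)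
    also have "(\<Sum>l\<le>k. (-1) ^ (k - l) * real (k choose l) * q s ^ (\<mu> - l)) = q s ^ (\<mu> - k) * (1 - q s) ^ k"
      by (rule alt)
    also have "\<dots> = (cmod (1 + z * cnj s) ^ 2) ^ (\<mu> - k) * (cmod (z - s) ^ 2) ^ k /
        (((1 + (cmod z)^2) * (1 + (cmod s)^2)) ^ (\<mu> - k) * ((1 + (cmod z)^2) * (1 + (cmod s)^2)) ^ k)"
      unfolding q1 unfolding q_def by (simp add: power_divide)
    also have "((1 + (cmod z)^2) * (1 + (cmod s)^2)) ^ (\<mu> - k) * ((1 + (cmod z)^2) * (1 + (cmod s)^2)) ^ k =
        (1 + (cmod z)^2) ^ \<mu> * (1 + (cmod s)^2) ^ \<mu>"
      unfolding power_add[symmetric] using k by (simp add: power_mult_distrib)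
    finally show "(\<Sum>l\<le>k. (-1) ^ (k - l) * of_nat (k choose l) * (f s * of_real (q s ^ (\<mu> - l)))) =
      f s * of_real ((cmod (1 + z * cnj s) ^ 2) ^ (\<mu> - k) * (cmod (z - s) ^ 2) ^ k /
       ((1 + (cmod z)^2) ^ \<mu> * (1 + (cmod s)^2) ^ \<mu>))" .
  qed
  finally show ?thesis .
qed

text \<open>Coordinates of \<open>(1 + s * cnj z) ^ (\<mu> - k) * (s - z) ^ k\<close> in the
  orthonormal basis. Up to normalisation this polynomial is \<open>s ^ k\<close> moved by the
  rotation of the sphere that takes \<open>z\<close> to the origin.\<close>

definition coherent_coeff :: "nat \<Rightarrow> nat \<Rightarrow> complex \<Rightarrow> nat \<Rightarrow> complex" where
  "coherent_coeff \<mu> k z a = of_real (1 / sqrt (real (\<mu> choose a))) * (\<Sum>i\<le>k. \<Sum>t\<le>\<mu> - k. if i + t = a then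
      of_nat (k choose i) * of_nat (\<mu> - k choose t) * ((- z) ^ (k - i) * cnj z ^ t) else 0)"

lemma coherent_expansion:
  assumes k: "k \<le> \<mu>"
  shows "(1 + s * cnj z) ^ (\<mu> - k) * (s - z) ^ k = (\<Sum>a\<le>\<mu>. coherent_coeff \<mu> k z a * onb \<mu> a s)"
proof -
  have 1: "(1 + s * cnj z) ^ (\<mu> - k) = (\<Sum>t\<le>\<mu> - k. of_nat (\<mu> - k choose t) * (s * cnj z) ^ t)"
    using binomial_ring[of "s * cnj z" 1 "\<mu> - k"] by (simp add: add.commute)
  have 2: "(s - z) ^ k = (\<Sum>i\<le>k. of_nat (k choose i) * s ^ i * (- z) ^ (k - i))"
    using binomial_ring[of s "- z" k] by simp
  have "(1 + s * cnj z) ^ (\<mu> - k) * (s - z) ^ k =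
      (\<Sum>i\<le>k. \<Sum>t\<le>\<mu> - k. of_nat (k choose i) * of_nat (\<mu> - k choose t) * ((- z) ^ (k - i) * cnj z ^ t) * s ^ (i + t))"
    unfolding 1 2 sum_product
    by (subst sum.swap) (simp add: power_mult_distrib power_add mult_ac)
  also have "\<dots> = (\<Sum>i\<le>k. \<Sum>t\<le>\<mu> - k. \<Sum>a\<le>\<mu>. if i + t = a then
      of_nat (k choose i) * of_nat (\<mu> - k choose t) * ((- z) ^ (k - i) * cnj z ^ t) * s ^ a else 0)"
    using k by (intro sum.cong refl) simp
  also have "\<dots> = (\<Sum>a\<le>\<mu>. \<Sum>i\<le>k. \<Sum>t\<le>\<mu> - k. if i + t = a then
      of_nat (k choose i) * of_nat (\<mu> - k choose t) * ((- z) ^ (k - i) * cnj z ^ t) * s ^ a else 0)"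
    by (rule sum_swap_double)
  also have "\<dots> = (\<Sum>a\<le>\<mu>. coherent_coeff \<mu> k z a * onb \<mu> a s)"
  proof (rule sum.cong[OF refl])
    fix a assume "a \<in> {..\<mu>}"
    then have 1: "of_real (1 / sqrt (real (\<mu> choose a))) * complex_of_real (sqrt (real (\<mu> choose a))) = 1"
      by (simp flip: of_real_mult)
    have "(r * X) * (q * y) = X * y" if "r * q = 1" for r q X y :: complex
      using that by (simp add: mult_ac)
    from this[OF 1] have "coherent_coeff \<mu> k z a * onb \<mu> a s = (\<Sum>i\<le>k. \<Sum>t\<le>\<mu> - k. if i + t = a then
        of_nat (k choose i) * of_nat (\<mu> - k choose t) * ((- z) ^ (k - i) * cnj z ^ t) else 0) * s ^ a"
      unfolding coherent_coeff_def onb_def .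
    also have "\<dots> = (\<Sum>i\<le>k. \<Sum>t\<le>\<mu> - k. if i + t = a then
      of_nat (k choose i) * of_nat (\<mu> - k choose t) * ((- z) ^ (k - i) * cnj z ^ t) * s ^ a else 0)"
      unfolding sum_distrib_right by (intro sum.cong refl) simp
    finally show "(\<Sum>i\<le>k. \<Sum>t\<le>\<mu> - k. if i + t = a then
      of_nat (k choose i) * of_nat (\<mu> - k choose t) * ((- z) ^ (k - i) * cnj z ^ t) * s ^ a else 0) = coherent_coeff \<mu> k z a * onb \<mu> a s" ..
  qed
  finally show ?thesis .
qed

text \<open>Here the two sides of the theorem meet: the limits of the Clebsch-Gordan coefficients
  are the coordinates of the normalised vector at \<open>z\<close>, apart from a phase. The sign
  \<open>(-1) ^ (k - i)\<close>, due to \<open>(cnj z - cnj w) ^ k\<close> in \<open>Jk\<close>,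
  comes here from \<open>(- z) ^ (k - i)\<close>.\<close>

lemma coherent_coeff_polar:
  assumes k: "k \<le> \<mu>" and z: "z \<noteq> 0"
  shows "of_real (sqrt (real (\<mu> choose k))) * coherent_coeff \<mu> k z a / of_real (sqrt (1 + (cmod z)^2) ^ \<mu>) =
    of_real (clebsch_gordan_limit \<mu> k a (sphere_coord z)) * sgn z powi (int k - int a)"
proof -
  define S where "S = complex_of_real (sqrt (1 + (cmod z)^2) ^ \<mu>)"
  have "(if i + t = a then of_nat (k choose i) * of_nat (\<mu> - k choose t) * ((- z) ^ (k - i) * cnj z ^ t) else 0) / S =
      of_real (if i + t = a then (-1) ^ (k - i) * real (k choose i) * real (\<mu> - k choose t) *
        (sqrt (sphere_coord z) ^ (k - i + t) * sqrt (1 - sphere_coord z) ^ (i + (\<mu> - k - t))) else 0) * sgn z powi (int k - int a)"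
    if "i \<le> k" "t \<le> \<mu> - k" for i t
  proof (cases "i + t = a")
    case True
    have e: "\<mu> - (k - i + t) = i + (\<mu> - k - t)" "int (k - i) - int t = int k - int a"
      using that k True by auto
    have "(- z) ^ (k - i) * cnj z ^ t / S = (-1) ^ (k - i) * (z ^ (k - i) * cnj z ^ t / S)"
      by (simp add: power_minus[of z])
    also have "z ^ (k - i) * cnj z ^ t / S = of_real (sqrt (sphere_coord z) ^ (k - i + t) * sqrt (1 - sphere_coord z) ^ (i + (\<mu> - k - t))) * sgn z powi (int k - int a)"
      unfolding S_def using that k by (subst monomial_polar[OF z]) (auto simp only: e)
    finally have "(- z) ^ (k - i) * cnj z ^ t / S = (-1) ^ (k - i) * (of_real (sqrt (sphere_coord z) ^ (k - i + t) * sqrt (1 - sphere_coord z) ^ (i + (\<mu> - k - t))) * sgn z powi (int k - int a))" .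
    then have "of_nat (k choose i) * of_nat (\<mu> - k choose t) * ((- z) ^ (k - i) * cnj z ^ t / S) =
        of_nat (k choose i) * of_nat (\<mu> - k choose t) * ((-1) ^ (k - i) * (of_real (sqrt (sphere_coord z) ^ (k - i + t) * sqrt (1 - sphere_coord z) ^ (i + (\<mu> - k - t))) * sgn z powi (int k - int a)))"
      by simp
    then show ?thesis using True by (simp add: mult_ac)
  qed simp
  then have "(\<Sum>i\<le>k. \<Sum>t\<le>\<mu> - k. if i + t = a then of_nat (k choose i) * of_nat (\<mu> - k choose t) * ((- z) ^ (k - i) * cnj z ^ t) else 0) / S =
     of_real (\<Sum>i\<le>k. \<Sum>t\<le>\<mu> - k. if i + t = a then (-1) ^ (k - i) * real (k choose i) * real (\<mu> - k choose t) *
        (sqrt (sphere_coord z) ^ (k - i + t) * sqrt (1 - sphere_coord z) ^ (i + (\<mu> - k - t))) else 0) * sgn z powi (int k - int a)"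
    unfolding sum_divide_distrib of_real_sum sum_distrib_right by (intro sum.cong refl) simp
  then show ?thesis
    unfolding coherent_coeff_def clebsch_gordan_limit_def S_def[symmetric] of_real_mult of_real_divide
    by (simp only: times_divide_eq_right[symmetric] mult.assoc) simp
qed

lemma cnj_sgn_power_int:
  assumes "z \<noteq> 0"
  shows "cnj (sgn z powi m) = sgn z powi (- m)"
proof -
  have "cnj (sgn z) = inverse (sgn z)"
    using assms complex_norm_square[of "sgn z"] by (simp add: norm_sgn sgn_zero_iff field_simps)
  then show ?thesis
    by (simp add: power_int_minus power_int_inverse)
qed

text \<open>The kernel of \<open>E\<close> is the squared modulus of the vector at \<open>z\<close>,
  so \<open>E\<close> is a quadratic form in its coordinates with matrix
  \<open>Rstar_matrix\<close>. Each product of two coordinates carries a phase that depends only on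
  the difference of their indices.\<close>

lemma E_eq_sum:
  assumes k: "k \<le> \<mu>" and f: "cont_CP1 f" and z: "z \<noteq> 0"
  shows "E \<mu> k f z = (\<Sum>e\<in>{- int \<mu>..int \<mu>}. fourier_coeff \<mu> k (Rstar_matrix \<mu> f) e (sphere_coord z) * sgn z powi (- e))"
proof -
  define V where "V = (\<lambda>s. (1 + s * cnj z) ^ (\<mu> - k) * (s - z) ^ k)"
  define w where "w = coherent_coeff \<mu> k z"
  define S where "S = sqrt (1 + (cmod z)^2) ^ \<mu>"
  have [measurable]: "f \<in> borel_measurable borel" by (rule cont_CP1_measurable[OF f])
  have [measurable]: "V \<in> borel_measurable borel" unfolding V_def by measurable
  have S2: "S * S = (1 + (cmod z)^2) ^ \<mu>"
    by (simp add: S_def flip: power_mult_distrib)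
  have S0: "S > 0" by (simp add: S_def)
  have V: "V s = (\<Sum>a\<le>\<mu>. w a * onb \<mu> a s)" for s
    unfolding V_def w_def by (rule coherent_expansion[OF k])
  have kernel: "of_real ((cmod (1 + z * cnj s) ^ 2) ^ (\<mu> - k) * (cmod (z - s) ^ 2) ^ k) = V s * cnj (V s)" for s
  proof -
    have "cmod (1 + z * cnj s) = cmod (1 + s * cnj z)"
      by (metis complex_mod_cnj complex_cnj_add complex_cnj_mult complex_cnj_cnj complex_cnj_one mult.commute)
    moreover have "cmod (z - s) = cmod (s - z)" by (rule norm_minus_commute)
    ultimately have "(cmod (1 + z * cnj s) ^ 2) ^ (\<mu> - k) * (cmod (z - s) ^ 2) ^ k = (cmod (V s))^2"
      by (simp add: V_def norm_mult norm_power power_mult_distrib power_mult[symmetric] mult.commute)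
    then show ?thesis by (simp only: complex_norm_square)
  qed
  have "E \<mu> k f z = of_nat (\<mu> choose k) * (LINT s|iota 0. f s * of_real ((cmod (1 + z * cnj s) ^ 2) ^ (\<mu> - k) * (cmod (z - s) ^ 2) ^ k /
       ((1 + (cmod z)^2) ^ \<mu> * (1 + (cmod s)^2) ^ \<mu>)))"
    by (rule E_eq_integral[OF k f])
  also have "\<dots> = of_nat (\<mu> choose k) * (LINT s|iota 0. 1 / of_real (S * S) * (f s * (V s * cnj (V s)) / of_real ((1 + (cmod s)^2) ^ \<mu>)))"
    unfolding of_real_divide[of "_ * _"] kernel unfolding S2 by (simp add: mult_ac)
  also have "\<dots> = of_nat (\<mu> choose k) / of_real (S * S) * (LINT s|iota 0. f s * (V s * cnj (V s)) / of_real ((1 + (cmod s)^2) ^ \<mu>))"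
    by (subst integral_mult_right_zero) simp
  \<comment> \<open>The weight goes back into the measure: the Berezin transform integrates against
    \<open>iota 0\<close>, the matrix entries against \<open>iota \<mu>\<close>.\<close>
  also have "(LINT s|iota 0. f s * (V s * cnj (V s)) / of_real ((1 + (cmod s)^2) ^ \<mu>)) =
      1 / (of_nat \<mu> + 1) * (LINT s|iota \<mu>. f s * (V s * cnj (V s)))"
  proof -
    have "of_nat \<mu> + 1 \<noteq> (0::complex)" by (metis of_nat_Suc of_nat_neq_0 add.commute)
    then show ?thesis by (subst integral_iota_eq(1)) (auto simp: add.commute)
  qed
  also have "(LINT s|iota \<mu>. f s * (V s * cnj (V s))) =
     (LINT s|iota \<mu>. (\<Sum>a\<le>\<mu>. \<Sum>a'\<le>\<mu>. (w a' * cnj (w a)) * (f s * (onb \<mu> a' s * cnj (onb \<mu> a s)))))"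
  proof (intro Bochner_Integration.integral_cong refl)
    fix s
    have "V s * cnj (V s) = (\<Sum>a\<le>\<mu>. \<Sum>a'\<le>\<mu>. (w a' * onb \<mu> a' s) * (cnj (w a) * cnj (onb \<mu> a s)))"
      unfolding V by (simp add: sum_product, subst sum.swap, simp)
    then show "f s * (V s * cnj (V s)) = (\<Sum>a\<le>\<mu>. \<Sum>a'\<le>\<mu>. (w a' * cnj (w a)) * (f s * (onb \<mu> a' s * cnj (onb \<mu> a s))))"
      by (simp add: sum_distrib_left mult_ac)
  qed
  also have "\<dots> = (\<Sum>a\<le>\<mu>. \<Sum>a'\<le>\<mu>. (w a' * cnj (w a)) * (LINT s|iota \<mu>. f s * (onb \<mu> a' s * cnj (onb \<mu> a s))))"
    by (intro integral_double_sum integrable_cont_CP1_mult[OF f] integrable_onb_onb) auto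
  also have "of_nat (\<mu> choose k) / of_real (S * S) * (1 / (of_nat \<mu> + 1) * \<dots>) =
      (\<Sum>a\<le>\<mu>. \<Sum>a'\<le>\<mu>. Rstar_matrix \<mu> f a a' * of_real (clebsch_gordan_limit \<mu> k a (sphere_coord z) * clebsch_gordan_limit \<mu> k a' (sphere_coord z)) * sgn z powi (- (int a' - int a)))"
    unfolding sum_distrib_left
  proof (intro sum.cong refl)
    fix a a'
    define c where "c = complex_of_real (sqrt (real (\<mu> choose k)))"
    have c: "c * c = of_nat (\<mu> choose k)" "cnj c = c" by (simp_all add: c_def flip: of_real_mult)
    have p: "c * w a / of_real S = of_real (clebsch_gordan_limit \<mu> k a (sphere_coord z)) * sgn z powi (int k - int a)" for a
      unfolding c_def w_def S_def by (rule coherent_coeff_polar[OF k z])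
    have u: "sgn z \<noteq> 0" using z by (simp add: sgn_zero_iff)
    have "of_nat (\<mu> choose k) / of_real (S * S) * (w a' * cnj (w a)) = (c * w a' / of_real S) * cnj (c * w a / of_real S)"
      by (simp add: c flip: c(1))
    also have "\<dots> = of_real (clebsch_gordan_limit \<mu> k a (sphere_coord z) * clebsch_gordan_limit \<mu> k a' (sphere_coord z)) * (sgn z powi (int k - int a') * sgn z powi (- (int k - int a)))"
      unfolding p complex_cnj_mult cnj_sgn_power_int[OF z] complex_cnj_complex_of_real of_real_mult
      by (simp only: mult_ac)
    \<comment> \<open>The common \<open>k\<close> cancels, and the phase becomes a function of the
      diagonal alone.\<close>
    also have "sgn z powi (int k - int a') * sgn z powi (- (int k - int a)) = sgn z powi (- (int a' - int a))"
      using u by (subst power_int_add[symmetric]) auto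
    finally have *: "of_nat (\<mu> choose k) / of_real (S * S) * (w a' * cnj (w a)) =
        of_real (clebsch_gordan_limit \<mu> k a (sphere_coord z) * clebsch_gordan_limit \<mu> k a' (sphere_coord z)) * sgn z powi (- (int a' - int a))" .
    have "of_nat (\<mu> choose k) / of_real (S * S) * (1 / (of_nat \<mu> + 1) * ((w a' * cnj (w a)) * (LINT s|iota \<mu>. f s * (onb \<mu> a' s * cnj (onb \<mu> a s))))) =
        Rstar_matrix \<mu> f a a' * (of_nat (\<mu> choose k) / of_real (S * S) * (w a' * cnj (w a)))"
      by (simp add: Rstar_matrix_def mult_ac)
    then show "of_nat (\<mu> choose k) / of_real (S * S) * (1 / (of_nat \<mu> + 1) * ((w a' * cnj (w a)) * (LINT s|iota \<mu>. f s * (onb \<mu> a' s * cnj (onb \<mu> a s))))) =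
        Rstar_matrix \<mu> f a a' * of_real (clebsch_gordan_limit \<mu> k a (sphere_coord z) * clebsch_gordan_limit \<mu> k a' (sphere_coord z)) * sgn z powi (- (int a' - int a))"
      unfolding * by (simp only: mult.assoc)
  qed
  also have "\<dots> = (\<Sum>a\<le>\<mu>. \<Sum>a'\<le>\<mu>. \<Sum>e\<in>{- int \<mu>..int \<mu>}. if int a' - int a = e
      then Rstar_matrix \<mu> f a a' * of_real (clebsch_gordan_limit \<mu> k a (sphere_coord z) * clebsch_gordan_limit \<mu> k a' (sphere_coord z)) * sgn z powi (- e) else 0)"
    by (intro sum.cong refl) (subst sum.delta', auto)
  also have "\<dots> = (\<Sum>e\<in>{- int \<mu>..int \<mu>}. \<Sum>a\<le>\<mu>. \<Sum>a'\<le>\<mu>. if int a' - int a = e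
      then Rstar_matrix \<mu> f a a' * of_real (clebsch_gordan_limit \<mu> k a (sphere_coord z) * clebsch_gordan_limit \<mu> k a' (sphere_coord z)) * sgn z powi (- e) else 0)"
    by (rule sum_swap_double)
  also have "\<dots> = (\<Sum>e\<in>{- int \<mu>..int \<mu>}. fourier_coeff \<mu> k (Rstar_matrix \<mu> f) e (sphere_coord z) * sgn z powi (- e))"
    unfolding fourier_coeff_def sum_distrib_right by (intro sum.cong refl) simp
  finally show ?thesis .
qed

section \<open>Powers of the symbol and their integral over the sphere\<close>

lemma fourier_coeff_pow_eq_0:
  assumes "\<bar>d\<bar> > int (n * \<mu>)"
  shows "fourier_coeff_pow \<mu> k A n d x = 0"
  using assms
proof (induction n arbitrary: d)
  case (Suc n)
  have "fourier_coeff_pow \<mu> k A n (d - e) x = 0" if "e \<in> {- int \<mu>..int \<mu>}" for e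
    using Suc.prems that by (intro Suc.IH) auto
  then show ?case by (simp add: sum.neutral)
qed auto

lemma fourier_coeff_sum_power:
  assumes u: "u \<noteq> 0"
  shows "(\<Sum>e\<in>{- int \<mu>..int \<mu>}. fourier_coeff \<mu> k A e x * u powi (- e)) ^ n =
    (\<Sum>d\<in>{- int (n * \<mu>)..int (n * \<mu>)}. fourier_coeff_pow \<mu> k A n d x * u powi (- d))"
proof (induction n)
  case 0
  show ?case by simp
next
  case (Suc n)
  define D where "D = (\<lambda>n. {- int (n * \<mu>)..int (n * \<mu>)})"
  have "(\<Sum>e\<in>{- int \<mu>..int \<mu>}. fourier_coeff \<mu> k A e x * u powi (- e)) ^ Suc n =
      (\<Sum>e\<in>{- int \<mu>..int \<mu>}. fourier_coeff \<mu> k A e x * u powi (- e)) * (\<Sum>d\<in>D n. fourier_coeff_pow \<mu> k A n d x * u powi (- d))"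
    using Suc by (simp add: D_def)
  also have "\<dots> = (\<Sum>e\<in>{- int \<mu>..int \<mu>}. \<Sum>d\<in>D n. fourier_coeff \<mu> k A e x * fourier_coeff_pow \<mu> k A n d x * u powi (- (d + e)))"
    unfolding sum_product using u by (intro sum.cong refl) (simp add: power_int_add power_int_diff field_simps power_int_minus)
  also have "\<dots> = (\<Sum>e\<in>{- int \<mu>..int \<mu>}. \<Sum>d\<in>D (Suc n). fourier_coeff \<mu> k A e x * fourier_coeff_pow \<mu> k A n (d - e) x * u powi (- d))"
  proof (rule sum.cong[OF refl])
    fix e assume e: "e \<in> {- int \<mu>..int \<mu>}"
    have "(\<Sum>d\<in>D n. fourier_coeff \<mu> k A e x * fourier_coeff_pow \<mu> k A n d x * u powi (- (d + e))) =
        (\<Sum>d\<in>(\<lambda>d. d + e) ` D n. fourier_coeff \<mu> k A e x * fourier_coeff_pow \<mu> k A n (d - e) x * u powi (- d))"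
      by (subst sum.reindex) (auto simp: inj_on_def)
    \<comment> \<open>The shifted range depends on \<open>e\<close>. Padding it with vanishing
      coefficients to the common range \<open>D (Suc n)\<close> allows the sums to be
      exchanged.\<close>
    also have "\<dots> = (\<Sum>d\<in>D (Suc n). fourier_coeff \<mu> k A e x * fourier_coeff_pow \<mu> k A n (d - e) x * u powi (- d))"
    proof (rule sum.mono_neutral_left)
      show "(\<lambda>d. d + e) ` D n \<subseteq> D (Suc n)" using e by (auto simp: D_def algebra_simps)
      show "\<forall>d\<in>D (Suc n) - (\<lambda>d. d + e) ` D n. fourier_coeff \<mu> k A e x * fourier_coeff_pow \<mu> k A n (d - e) x * u powi (- d) = 0"
      proof
        fix d assume "d \<in> D (Suc n) - (\<lambda>d. d + e) ` D n"
        then have "d - e \<notin> D n" by (metis DiffD2 diff_add_cancel imageI)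
        then have "fourier_coeff_pow \<mu> k A n (d - e) x = 0" by (intro fourier_coeff_pow_eq_0) (auto simp: D_def)
        then show "fourier_coeff \<mu> k A e x * fourier_coeff_pow \<mu> k A n (d - e) x * u powi (- d) = 0" by simp
      qed
    qed (simp add: D_def)
    finally show "(\<Sum>d\<in>D n. fourier_coeff \<mu> k A e x * fourier_coeff_pow \<mu> k A n d x * u powi (- (d + e))) =
      (\<Sum>d\<in>D (Suc n). fourier_coeff \<mu> k A e x * fourier_coeff_pow \<mu> k A n (d - e) x * u powi (- d))" .
  qed
  also have "\<dots> = (\<Sum>d\<in>D (Suc n). fourier_coeff_pow \<mu> k A (Suc n) d x * u powi (- d))"
    unfolding fourier_coeff_pow.simps sum_distrib_right by (rule sum.swap)
  finally show ?case by (simp only: D_def)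
qed

lemma continuous_on_clebsch_gordan_limit: "continuous_on UNIV (clebsch_gordan_limit \<mu> k a)"
proof -
  have "continuous_on UNIV (\<lambda>x. if i + s = a then (-1) ^ (k - i) * real (k choose i) * real (\<mu> - k choose s) *
        (sqrt x ^ (k - i + s) * sqrt (1 - x) ^ (i + (\<mu> - k - s))) else 0)" for i s
    by (cases "i + s = a") (auto intro!: continuous_intros)
  then show ?thesis unfolding clebsch_gordan_limit_def by (intro continuous_intros) auto
qed

lemma continuous_on_fourier_coeff: "continuous_on UNIV (fourier_coeff \<mu> k A d)"
proof -
  have "continuous_on UNIV (\<lambda>x. if int a' - int a = d then A a a' * of_real (clebsch_gordan_limit \<mu> k a x * clebsch_gordan_limit \<mu> k a' x) else 0)" for a a'
    by (cases "int a' - int a = d") (auto intro!: continuous_intros continuous_on_clebsch_gordan_limit)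
  then show ?thesis unfolding fourier_coeff_def by (intro continuous_intros) auto
qed

lemma continuous_on_fourier_coeff_pow: "continuous_on UNIV (fourier_coeff_pow \<mu> k A n d)"
proof (induction n arbitrary: d)
  case (Suc n)
  then show ?case unfolding fourier_coeff_pow.simps by (intro continuous_intros continuous_on_fourier_coeff) auto
qed simp

lemma integrable_iota_polar:
  fixes \<phi> :: "real \<Rightarrow> complex"
  assumes \<phi>: "continuous_on UNIV \<phi>"
  shows "integrable (iota 0) (\<lambda>z. \<phi> (sphere_coord z) * sgn z powi d)"
proof -
  have "bounded (\<phi> ` {0..1})"
    by (intro compact_imp_bounded compact_continuous_image continuous_on_subset[OF \<phi>]) auto
  then obtain B where B: "\<And>x. x \<in> {0..1} \<Longrightarrow> cmod (\<phi> x) \<le> B" unfolding bounded_iff by blast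
  have B0: "B \<ge> 0" using order_trans[OF norm_ge_zero B[of 0]] by simp
  have [measurable]: "\<phi> \<in> borel_measurable borel" using \<phi> by (rule borel_measurable_continuous_onI)
  have "cmod (sgn z powi d) \<le> 1" for z :: complex
    by (cases "z = 0") (auto simp: norm_power_int norm_sgn power_int_0_left_if)
  then have "cmod (\<phi> (sphere_coord z) * sgn z powi d) \<le> B" for z
    using mult_mono[OF B[of "sphere_coord z"], of "cmod (sgn z powi d)" 1] B0 by (simp add: norm_mult less_imp_le)
  then show ?thesis by (intro integrable_iota_bound[where K=B]) auto
qed

text \<open>Integration over the phase leaves the term \<open>d = 0\<close>, a function of the
  height alone, and the height is uniform on the unit interval.\<close>

lemma integral_E_power:
  assumes k: "k \<le> \<mu>" and f: "cont_CP1 f"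
  shows "(LINT z|iota 0. E \<mu> k f z ^ n) = integral {0..1} (fourier_coeff_pow \<mu> k (Rstar_matrix \<mu> f) n 0)"
proof -
  define p where "p = fourier_coeff_pow \<mu> k (Rstar_matrix \<mu> f) n"
  define D where "D = {- int (n * \<mu>)..int (n * \<mu>)}"
  have cont: "continuous_on UNIV (p d)" for d unfolding p_def by (rule continuous_on_fourier_coeff_pow)
  have [measurable]: "p d \<in> borel_measurable borel" for d using cont by (rule borel_measurable_continuous_onI)
  have eq: "E \<mu> k f z ^ n = (\<Sum>d\<in>D. p d (sphere_coord z) * sgn z powi (- d))" if "z \<noteq> 0" for z
    using that by (simp add: E_eq_sum[OF k f that] fourier_coeff_sum_power sgn_zero_iff p_def D_def)
  \<comment> \<open>The value at 0 is kept as a constant, so this integrand equals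
    \<open>E ^ n\<close> everywhere and is visibly measurable. The polar form can then replace it
    almost everywhere without a separate measurability proof for \<open>E\<close>.\<close>
  have "(LINT z|iota 0. E \<mu> k f z ^ n) = (LINT z|iota 0. (if z = 0 then E \<mu> k f 0 ^ n else (\<Sum>d\<in>D. p d (sphere_coord z) * sgn z powi (- d))))"
    by (intro Bochner_Integration.integral_cong refl) (simp add: eq)
  also have "\<dots> = (LINT z|iota 0. (\<Sum>d\<in>D. p d (sphere_coord z) * sgn z powi (- d)))"
  proof (intro integral_cong_AE)
    show "AE z in iota 0. (if z = 0 then E \<mu> k f 0 ^ n else (\<Sum>d\<in>D. p d (sphere_coord z) * sgn z powi (- d))) =
        (\<Sum>d\<in>D. p d (sphere_coord z) * sgn z powi (- d))"
      using AE_iota_nonzero by eventually_elim simp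
  qed measurable
  also have "\<dots> = (\<Sum>d\<in>D. LINT z|iota 0. p d (sphere_coord z) * sgn z powi (- d))"
    by (intro Bochner_Integration.integral_sum integrable_iota_polar cont)
  also have "\<dots> = (\<Sum>d\<in>D. if d = 0 then integral {0..1} (p d) else 0)"
    by (intro sum.cong refl) (simp add: integral_iota_polar[OF cont])
  also have "\<dots> = integral {0..1} (p 0)" by (simp add: D_def)
  finally show ?thesis unfolding p_def .
qed

theorem mainTheorem9:
  fixes \<mu> k n :: nat and f :: "complex \<Rightarrow> complex"
  assumes "k \<le> \<mu>" and "cont_CP1 f" and "n > 0"
  shows "(\<lambda>\<nu>. trace_H (\<mu> + \<nu> - 2 * k) ((Tmap \<mu> \<nu> k (Rstar \<mu> f)) ^^ n) / of_nat \<nu>)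
           \<longlonglongrightarrow> (LINT z|iota 0. (E \<mu> k f z) ^ n)"
proof -
  \<comment> \<open>The uniform bound holds for \<open>k \<le> \<nu>\<close> only, while the
    averaging lemma asks for it at every \<nu>; the value 0 fills the gap.\<close>
  define h where "h = (\<lambda>\<nu> j. if k \<le> \<nu> then transfer_matrix_pow \<mu> \<nu> k (Rstar_matrix \<mu> f) n j j else 0)"
  obtain K where K: "\<And>\<nu> i j. k \<le> \<nu> \<Longrightarrow> cmod (transfer_matrix_pow \<mu> \<nu> k (Rstar_matrix \<mu> f) n i j) \<le> K"
    using transfer_matrix_pow_bounded[OF assms(1)] by blast
  have K0: "K \<ge> 0" using K[of k 0 0] norm_ge_zero order_trans by blast
  have ev: "\<forall>\<^sub>F \<nu> in sequentially. k \<le> \<nu>" by (rule eventually_ge_at_top)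
  have "(\<lambda>\<nu>. (\<Sum>j\<le>\<mu> + \<nu> - 2 * k. h \<nu> j) / of_nat \<nu>) \<longlonglongrightarrow> integral {0..1} (fourier_coeff_pow \<mu> k (Rstar_matrix \<mu> f) n 0)"
  proof (rule mean_tendsto_integral_shifted)
    show "cmod (h \<nu> j) \<le> K" for \<nu> j using K K0 by (simp add: h_def)
    \<comment> \<open>The constant \<open>\<mu> + 2 * k\<close> covers both inequalities, including
      the small \<nu> for which the subtraction truncates.\<close>
    show "\<nu> \<le> \<mu> + \<nu> - 2 * k + (\<mu> + 2 * k)" "\<mu> + \<nu> - 2 * k \<le> \<nu> + (\<mu> + 2 * k)" for \<nu> by auto
    fix x :: real assume x: "0 < x" "x < 1"
    define i where "i = (\<lambda>\<nu>::nat. nat \<lfloor>real \<nu> * x\<rfloor>)"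
    have "(\<lambda>\<nu>. real (i \<nu>) / real \<nu>) \<longlonglongrightarrow> x"
    proof -
      have "(\<lambda>\<nu>. real_of_int \<lfloor>real \<nu> * x\<rfloor> / real \<nu>) \<longlonglongrightarrow> x" using x by real_asymp
      then show ?thesis using x by (simp add: i_def)
    qed
    \<comment> \<open>Row and column sequences coincide on the diagonal, which selects the offset
      0.\<close>
    from transfer_matrix_pow_tendsto[OF assms(1) this x, of i 0 "Rstar_matrix \<mu> f" n]
    have "(\<lambda>\<nu>. transfer_matrix_pow \<mu> \<nu> k (Rstar_matrix \<mu> f) n (i \<nu>) (i \<nu>)) \<longlonglongrightarrow> fourier_coeff_pow \<mu> k (Rstar_matrix \<mu> f) n 0 x" by simp
    moreover have "\<forall>\<^sub>F \<nu> in sequentially. transfer_matrix_pow \<mu> \<nu> k (Rstar_matrix \<mu> f) n (i \<nu>) (i \<nu>) = h \<nu> (nat \<lfloor>real \<nu> * x\<rfloor>)"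
      using ev by eventually_elim (simp add: h_def i_def)
    ultimately show "(\<lambda>\<nu>. h \<nu> (nat \<lfloor>real \<nu> * x\<rfloor>)) \<longlonglongrightarrow> fourier_coeff_pow \<mu> k (Rstar_matrix \<mu> f) n 0 x"
      by (rule Lim_transform_eventually)
  qed
  moreover have "\<forall>\<^sub>F \<nu> in sequentially. (\<Sum>j\<le>\<mu> + \<nu> - 2 * k. h \<nu> j) / of_nat \<nu> =
      trace_H (\<mu> + \<nu> - 2 * k) ((Tmap \<mu> \<nu> k (Rstar \<mu> f)) ^^ n) / of_nat \<nu>"
    using ev by eventually_elim (simp add: h_def trace_H_Tmap_funpow assms)
  ultimately show ?thesis
    unfolding integral_E_power[OF assms(1,2)] by (rule Lim_transform_eventually)
qed

end
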